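(* Let $d\ge 3$ and let $(X(t))_{t\ge t_0}$ be the vertex-reinforced random walk on the complete-like graph $\mathcal G_d$ (with arbitrary leaf numbers $r_1,\dots,r_d\ge 0$ and arbitrary positive integer initial weights). Then $\mathbb P(\pi_\infty=\pi_{\mathsf{unif}})=1$.
   Context: Let $d\ge 2$ and $r_1,\dots,r_d\ge 0$ be integers. The complete-like graph $\mathcal G_d$ has vertex set $V_d=\{1,\dots,d\}\cup\{\ell^i_r: 1\le i\le d,\ 1\le r\le r_i\}$. The vertices $1,\dots,d$ are called interior, and every pair of distinct interior vertices is joined by an edge; for each $i$, the vertices $\ell^i_1,\dots,\ell^i_{r_i}$ are the leaves attached to $i$, each joined by an edge to $i$ only; there are no other edges. Write $v\sim w$ if $v,w$ are joined by an edge. Vertex-reinforced random walk (VRRW) on $\mathcal G_d$: fix positive integers $z(0,v)$, $v\in V_d$, put $t_0=\sum_{v\in V_d}z(0,v)$, let $X(t_0)\in V_d$ be a given starting vertex, and for $t\ge t_0$ let $Z(t,v)=z(0,v)+\#\{s\in\{t_0+1,\dots,t\}: X(s)=v\}$ (so $\sum_v Z(t,v)=t$). Let $\mathcal F_t=\sigma(X(s),t_0\le s\le t)$. The transitions are $\mathbb P(X(t+1)=w\mid\mathcal F_t)=Z(t,w)/\sum_{y\sim X(t)}Z(t,y)$ for $w\sim X(t)$. Let $\pi(t)=(Z(t,v)/t)_{v\in V_d}\in\mathbb R^{|V_d|}$ be the empirical occupation measure, let $\pi_\infty=\lim_{t\to\infty}\pi(t)$ on the event that this limit exists and $\pi_\infty=0$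 (zero vector) otherwise, and let $\pi_{\mathsf{unif}}\in\mathbb R^{|V_d|}$ be the vector with coordinate $1/d$ at each interior vertex and $0$ at each leaf. *)

theory Defs
  imports "HOL-Probability.Probability"
begin

datatype vtx = Inner nat | Leaf nat nat

definition verts :: "nat \<Rightarrow> (nat \<Rightarrow> nat) \<Rightarrow> vtx set" where
  "verts d r = {Inner i | i. 1 \<le> i \<and> i \<le> d}
              \<union> {Leaf i k | i k. 1 \<le> i \<and> i \<le> d \<and> 1 \<le> k \<and> k \<le> r i}"

fun adj :: "vtx \<Rightarrow> vtx \<Rightarrow> bool" where
  "adj (Inner i) (Inner j) = (i \<noteq> j)"
| "adj (Inner i) (Leaf j k) = (i = j)"
| "adj (Leaf j k) (Inner i) = (i = j)"
| "adj (Leaf i k) (Leaf j l) = False"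

definition tzero :: "nat \<Rightarrow> (nat \<Rightarrow> nat) \<Rightarrow> (vtx \<Rightarrow> nat) \<Rightarrow> nat" where
  "tzero d r z0 = (\<Sum>v\<in>verts d r. z0 v)"

text \<open>Weights after a history h = [X(t0), X(t0+1), ..., X(t0+n)].\<close>
definition Zhist :: "(vtx \<Rightarrow> nat) \<Rightarrow> vtx list \<Rightarrow> vtx \<Rightarrow> nat" where
  "Zhist z0 h v = z0 v + length (filter (\<lambda>u. u = v) (tl h))"

definition vrrw_trans :: "nat \<Rightarrow> (nat \<Rightarrow> nat) \<Rightarrow> (vtx \<Rightarrow> nat) \<Rightarrow> vtx list \<Rightarrow> vtx \<Rightarrow> real" where
  "vrrw_trans d r z0 h w =
     (if w \<in> verts d r \<and> adj (last h) w
      then real (Zhist z0 h w) / (\<Sum>y\<in>{y \<in> verts d r. adj (last h) y}. real (Zhist z0 h y))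
      else 0)"

text \<open>X n is X(t0+n). The law of a VRRW started at x0: measurable process with
  X(t0) = x0 a.s. and the prescribed conditional transition probabilities given
  the whole past (stated on cylinder events, which determine the law).\<close>
definition vrrw_law ::
  "'w measure \<Rightarrow> nat \<Rightarrow> (nat \<Rightarrow> nat) \<Rightarrow> (vtx \<Rightarrow> nat) \<Rightarrow> vtx \<Rightarrow> (nat \<Rightarrow> 'w \<Rightarrow> vtx) \<Rightarrow> bool" where
  "vrrw_law M d r z0 x0 X \<longleftrightarrow>
     (\<forall>n. X n \<in> measurable M (count_space UNIV)) \<and>
     (AE \<omega> in M. X 0 \<omega> = x0) \<and>
     (\<forall>n h w. length h = Suc n \<longrightarrow>
        measure M {\<omega> \<in> space M. (\<forall>s\<le>n. X s \<omega> = h ! s) \<and> X (Suc n) \<omega> = w}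
        = measure M {\<omega> \<in> space M. \<forall>s\<le>n. X s \<omega> = h ! s} * vrrw_trans d r z0 h w)"

definition Zcnt :: "(vtx \<Rightarrow> nat) \<Rightarrow> (nat \<Rightarrow> 'w \<Rightarrow> vtx) \<Rightarrow> nat \<Rightarrow> 'w \<Rightarrow> vtx \<Rightarrow> nat" where
  "Zcnt z0 X n \<omega> v = z0 v + card {s \<in> {1..n}. X s \<omega> = v}"

definition occ :: "nat \<Rightarrow> (nat \<Rightarrow> nat) \<Rightarrow> (vtx \<Rightarrow> nat) \<Rightarrow> (nat \<Rightarrow> 'w \<Rightarrow> vtx) \<Rightarrow> nat \<Rightarrow> 'w \<Rightarrow> vtx \<Rightarrow> real" where
  "occ d r z0 X n \<omega> v =
     (if v \<in> verts d r then real (Zcnt z0 X n \<omega> v) / real (tzero d r z0 + n) else 0)"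

definition pi_inf :: "nat \<Rightarrow> (nat \<Rightarrow> nat) \<Rightarrow> (vtx \<Rightarrow> nat) \<Rightarrow> (nat \<Rightarrow> 'w \<Rightarrow> vtx) \<Rightarrow> 'w \<Rightarrow> vtx \<Rightarrow> real" where
  "pi_inf d r z0 X \<omega> =
     (if \<exists>L. \<forall>v. (\<lambda>n. occ d r z0 X n \<omega> v) \<longlonglongrightarrow> L v
      then (THE L. \<forall>v. (\<lambda>n. occ d r z0 X n \<omega> v) \<longlonglongrightarrow> L v)
      else (\<lambda>_. 0))"

definition pi_unif :: "nat \<Rightarrow> vtx \<Rightarrow> real" where
  "pi_unif d v = (case v of Inner i \<Rightarrow> (if 1 \<le> i \<and> i \<le> d then 1 / real d else 0) | Leaf _ _ \<Rightarrow> 0)"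

end

theory Submission
  imports Defs
begin

text \<open>
  Write $Z_i$ for the weight of the interior vertex $i$, $L_i$ for the total weight of its leaves,
  $N_i$ for the total weight of the neighbours of $i$ and $T$ for the total weight. Each visit to a
  vertex raises the logarithm of its weight by about the inverse of that weight, so up to convergent
  martingales $\ln Z_i$ equals the sum of $1/N_m$ over the visits to interior $m \ne i$ plus the sum
  of $1/Z_i$ over the visits to the leaves of $i$, and $\ln L_i$ equals the sum of $1/N_i$ over the
  visits to $i$.

  As $d \ge 3$, the difference $\ln Z_j - \ln L_i$ with $j \ne i$ is, up to a bounded error, at
  least the sum of $1/N_m$ over the visits to the remaining interior vertices $m$. Hence
  $L_i \le C Z_j$, and $\sum L_i/T^2$ over the visits to any $m \ne i$ is finite. From $i$ the walk
  steps to a leaf with probability $L_i/N_i$, which is bounded away from $1$, so the visits to $i$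
  are controlled by the moves from $i$ to other interior vertices, and $\sum L_i/T^2$ is finite over
  all times.

  Finally $\sum_i \ln Z_i$ is at most $d \ln T$ up to a constant. The proportion $y_i = Z_i/T$
  averages the visits to $i$, so in the long run a visit to $i$ may be replaced by the weight $y_i$,
  and the tangent of the convex function $1/(1-y)$ at $1/d$ shows that $\sum_i \ln Z_i - d \ln T$
  dominates a multiple of $\sum_t \sum_i (y_i - 1/d)^2/T$. So this series converges, and since the
  proportions vary by at most $1/T$ per step they tend to $1/d$.
\<close>

section \<open>Real sequences\<close>

lemma convergent_if_slowly_varying:
  fixes u a :: "nat \<Rightarrow> real"
  assumes u_nonneg: "\<And>k. 0 \<le> u k" and slow: "\<And>k. \<bar>u (Suc k) - u k\<bar> \<le> c * a k"
    and squares: "summable (\<lambda>k. (a k)\<^sup>2)" and weighted: "summable (\<lambda>k. a k * u k)"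
  shows "convergent u"
proof -
  have square_slow: "\<bar>(u (Suc k))\<^sup>2 - (u k)\<^sup>2\<bar> \<le> 2 * c * (a k * u k) + c\<^sup>2 * (a k)\<^sup>2" for k
  proof -
    have "\<bar>(u (Suc k))\<^sup>2 - (u k)\<^sup>2\<bar> = \<bar>u (Suc k) - u k\<bar> * (u (Suc k) + u k)"
      using u_nonneg[of k] u_nonneg[of "Suc k"]
      by (simp add: power2_eq_square square_diff_square_factored abs_mult mult.commute)
    also have "\<dots> \<le> c * a k * (2 * u k + c * a k)"
      using slow[of k] u_nonneg[of k] u_nonneg[of "Suc k"] by (intro mult_mono) linarith+
    finally show ?thesis by (simp add: algebra_simps power2_eq_square)
  qed
  have "summable (\<lambda>k. 2 * c * (a k * u k) + c\<^sup>2 * (a k)\<^sup>2)"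
    by (intro summable_add summable_mult weighted squares)
  then have "summable (\<lambda>k. (u (Suc k))\<^sup>2 - (u k)\<^sup>2)"
    by (rule summable_comparison_test') (use square_slow in simp)
  then have "convergent (\<lambda>k. (u k)\<^sup>2)"
    by (simp add: summable_iff_convergent sum_lessThan_telescope[of "\<lambda>k. (u k)\<^sup>2"]
        convergent_diff_const_right_iff)
  then obtain l where "(\<lambda>k. (u k)\<^sup>2) \<longlonglongrightarrow> l" by (auto simp: convergent_def)
  from tendsto_real_sqrt[OF this] show ?thesis using u_nonneg by (auto simp: convergent_def)
qed

lemma tendsto_zero_if_slowly_varying:
  fixes u a :: "nat \<Rightarrow> real"
  assumes u_nonneg: "\<And>k. 0 \<le> u k" and slow: "\<And>k. \<bar>u (Suc k) - u k\<bar> \<le> c * a k"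
    and squares: "summable (\<lambda>k. (a k)\<^sup>2)" and weighted: "summable (\<lambda>k. a k * u k)"
    and a_nonneg: "\<And>k. 0 \<le> a k" and not_summable: "\<not> summable a"
  shows "u \<longlonglongrightarrow> 0"
proof -
  obtain l where lim: "u \<longlonglongrightarrow> l"
    using convergent_if_slowly_varying[OF u_nonneg slow squares weighted]
    by (auto simp: convergent_def)
  have "\<not> 0 < l"
  proof
    assume pos: "0 < l"
    then have "\<forall>\<^sub>F k in sequentially. l / 2 < u k"
      using lim by (intro order_tendstoD(1)) auto
    then have "\<forall>\<^sub>F k in sequentially. norm (a k) \<le> 2 / l * (a k * u k)"
    proof eventually_elim
      case (elim k)
      have "a k * (l / 2) \<le> a k * u k" using elim a_nonneg by (intro mult_left_mono) auto
      then show ?case using pos a_nonneg[of k] by (simp add: field_simps)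
    qed
    then have "summable a"
      by (rule summable_comparison_test_ev) (intro summable_mult weighted)
    with not_summable show False by contradiction
  qed
  moreover have "0 \<le> l" using lim u_nonneg by (intro LIMSEQ_le_const) auto
  ultimately show ?thesis using lim by simp
qed

lemma summable_imp_bounded_partial_sums:
  fixes f :: "nat \<Rightarrow> real"
  assumes "summable f"
  obtains C where "\<And>n. \<bar>\<Sum>k<n. f k\<bar> \<le> C"
proof -
  have "Bseq (\<lambda>n. \<Sum>k<n. f k)"
    using assms by (intro convergent_imp_Bseq) (simp add: summable_iff_convergent)
  then obtain C where "\<forall>n. norm (\<Sum>k<n. f k) \<le> C" by (auto elim: BseqE)
  then show ?thesis by (intro that[of C]) simp
qed

lemma sum_mult_exp_neg_partial_sums_le:
  fixes b :: "nat \<Rightarrow> real"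
  assumes b: "\<And>k. 0 \<le> b k" "\<And>k. b k \<le> c"
  shows "(\<Sum>k<n. b k * exp (- (\<Sum>j<k. b j))) \<le> exp c"
proof -
  define E where "E k = exp (- (\<Sum>j<k. b j))" for k
  have drop: "b k * E k \<le> exp c * (E k - E (Suc k))" for k
  proof -
    have "b k * E k = exp (b k) * (b k * E (Suc k))"
      by (simp add: E_def exp_diff exp_minus field_simps)
    also have "\<dots> \<le> exp c * (b k * E (Suc k))"
      using b by (intro mult_right_mono) (auto simp: E_def)
    also have "b k * E (Suc k) \<le> (exp (b k) - 1) * E (Suc k)"
      using exp_ge_add_one_self[of "b k"]
      by (intro mult_right_mono) (auto simp: E_def algebra_simps)
    also have "\<dots> = E k - E (Suc k)" by (simp add: E_def exp_diff exp_minus field_simps)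
    finally show ?thesis by simp
  qed
  have "(\<Sum>k<n. b k * E k) \<le> exp c * (E 0 - E n)"
    unfolding sum_lessThan_telescope'[symmetric] sum_distrib_left by (intro sum_mono drop)
  also have "\<dots> \<le> exp c * 1" by (intro mult_left_mono) (auto simp: E_def)
  finally show ?thesis by (simp add: E_def)
qed

locale unit_growth =
  fixes Y e :: "nat \<Rightarrow> real"
  assumes Y_Suc: "Y (Suc k) = Y k + e k" and Y_0: "1 \<le> Y 0"
    and e_nonneg: "0 \<le> e k" and e_le_1: "e k \<le> 1"
begin

lemma Y_ge_1: "1 \<le> Y n"
  by (induction n) (auto simp: Y_0 Y_Suc e_nonneg add_increasing2)

lemma ln_Y_Suc: "ln (Y (Suc k)) = ln (Y k) + ln (1 + e k / Y k)"
proof -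
  have "Y (Suc k) = Y k * (1 + e k / Y k)" using Y_ge_1[of k] by (simp add: Y_Suc distrib_left)
  moreover have "0 < 1 + e k / Y k" using Y_ge_1[of k] e_nonneg[of k] by (intro add_pos_nonneg) auto
  ultimately show ?thesis using Y_ge_1[of k] by (simp add: ln_mult_pos)
qed

lemma ln_Y_le: "ln (Y n) \<le> ln (Y 0) + (\<Sum>k<n. e k / Y k)"
proof (induction n)
  case (Suc n)
  have "ln (1 + e n / Y n) \<le> e n / Y n"
    using Y_ge_1[of n] e_nonneg[of n] by (intro ln_add_one_self_le_self) auto
  with Suc show ?case by (simp add: ln_Y_Suc)
qed simp

lemma sum_over_Y_squared_le: "(\<Sum>k<n. e k / (Y k)\<^sup>2) \<le> 2"
proof -
  have step: "e k / (Y k)\<^sup>2 \<le> 2 / Y k - 2 / Y (Suc k)" for k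
  proof -
    have "e k / (Y k)\<^sup>2 = 2 * e k / (Y k * (2 * Y k))" by (simp add: power2_eq_square)
    also have "\<dots> \<le> 2 * e k / (Y k * Y (Suc k))"
      using Y_ge_1[of k] e_nonneg[of k] e_le_1[of k]
      by (intro divide_left_mono mult_left_mono mult_pos_pos) (auto simp: Y_Suc)
    also have "\<dots> = 2 / Y k - 2 / Y (Suc k)"
      using Y_ge_1[of k] Y_ge_1[of "Suc k"] by (simp add: divide_simps) (simp add: Y_Suc)
    finally show ?thesis .
  qed
  have "(\<Sum>k<n. e k / (Y k)\<^sup>2) \<le> 2 / Y 0 - 2 / Y n"
    unfolding sum_lessThan_telescope'[of "\<lambda>k. 2 / Y k", symmetric] by (intro sum_mono step)
  also have "\<dots> \<le> 2"
  proof -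
    have "2 / Y 0 \<le> 2" "0 \<le> 2 / Y n" using Y_0 Y_ge_1[of n] by (simp_all add: divide_le_eq)
    then show ?thesis by linarith
  qed
  finally show ?thesis .
qed

lemma sum_over_Y_le: "(\<Sum>k<n. e k / Y k) \<le> ln (Y n) + 2"
proof -
  have "(\<Sum>k<n. e k / Y k) \<le> ln (Y n) - ln (Y 0) + (\<Sum>k<n. e k / (Y k)\<^sup>2)"
  proof (induction n)
    case (Suc n)
    have ratio: "0 \<le> e n / Y n" "e n / Y n \<le> 1"
      using Y_ge_1[of n] e_nonneg[of n] e_le_1[of n] by (auto simp: divide_le_eq)
    have "e n / Y n \<le> ln (1 + e n / Y n) + (e n / Y n)\<^sup>2"
      using ln_one_plus_pos_lower_bound[OF ratio] by simp
    also have "(e n / Y n)\<^sup>2 \<le> e n / (Y n)\<^sup>2"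
      using mult_left_le[OF e_le_1[of n] e_nonneg[of n]]
      by (simp add: power_divide power2_eq_square[of "e n"] divide_right_mono)
    finally show ?case using Suc by (simp add: ln_Y_Suc)
  qed simp
  moreover have "0 \<le> ln (Y 0)" using Y_0 by (rule ln_ge_zero)
  ultimately show ?thesis using sum_over_Y_squared_le[of n] by linarith
qed

end

locale clock =
  fixes T :: "nat \<Rightarrow> real"
  assumes T_Suc: "T (Suc n) = T n + 1" and T_0_ge_1: "1 \<le> T 0"
begin

lemma T_eq_add: "T n = T 0 + real n"
  by (induction n) (auto simp: T_Suc)

lemma T_ge_1: "1 \<le> T n"
  using T_0_ge_1 by (simp add: T_eq_add[of n])

lemma T_pos [simp]: "0 < T n" and T_nonneg [simp]: "0 \<le> T n" and T_neq_0 [simp]: "T n \<noteq> 0"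
  using T_ge_1[of n] by auto

lemma unit_growth_T_Suc: "unit_growth (\<lambda>n. T (Suc n)) (\<lambda>_. 1)"
  by unfold_locales (auto simp: T_Suc)

lemma ln_T_Suc_le: "ln (T (Suc n)) \<le> ln (T 1) + (\<Sum>k<n. 1 / T (Suc k))"
  using unit_growth.ln_Y_le[OF unit_growth_T_Suc] by simp

lemma sum_inverse_T_squared_le: "(\<Sum>k<n. (1 / T (Suc k))\<^sup>2) \<le> 2"
  using unit_growth.sum_over_Y_squared_le[OF unit_growth_T_Suc] by (simp add: power_divide)

lemma summable_inverse_T_squared: "summable (\<lambda>k. (1 / T (Suc k))\<^sup>2)"
  by (rule summableI_nonneg_bounded[OF _ sum_inverse_T_squared_le]) simp

lemma not_summable_inverse_T: "\<not> summable (\<lambda>k. 1 / T (Suc k))"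
proof
  assume "summable (\<lambda>k. 1 / T (Suc k))"
  then have "summable (\<lambda>k. (T 0 + 1) * (1 / T (Suc k)))" by (rule summable_mult)
  then have "summable (\<lambda>k. inverse (real (Suc k)))"
  proof (rule summable_comparison_test')
    show "norm (inverse (real (Suc k))) \<le> (T 0 + 1) * (1 / T (Suc k))" for k
      using T_0_ge_1 T_ge_1[of "Suc k"] by (simp add: T_eq_add[of "Suc k"] field_simps)
  qed
  then have "summable (\<lambda>k. inverse (real k))" by (subst (asm) summable_Suc_iff)
  with not_summable_harmonic show False by contradiction
qed

end

locale proportion = clock +
  fixes Y e :: "nat \<Rightarrow> real"
  assumes Y_Suc: "Y (Suc k) = Y k + e k" and Y_0: "0 \<le> Y 0" "Y 0 \<le> T 0"
    and e_nonneg: "0 \<le> e k" and e_le_1: "e k \<le> 1"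
begin

definition ratio :: "nat \<Rightarrow> real" where "ratio k = Y k / T k"

lemma Y_bounds: "0 \<le> Y k" "Y k \<le> T k"
  using Y_0 e_nonneg e_le_1 by (induction k) (auto simp: Y_Suc T_Suc add_mono)

lemma ratio_bounds: "0 \<le> ratio k" "ratio k \<le> 1"
  using Y_bounds[of k] by (auto simp: ratio_def divide_le_eq)

lemma ratio_Suc: "ratio (Suc k) = ratio k + (e k - ratio k) / T (Suc k)"
  using T_ge_1[of k] by (simp add: ratio_def Y_Suc T_Suc divide_simps) (simp add: algebra_simps)

lemma ratio_le_ratio_Suc: "e k = 1 \<Longrightarrow> ratio k \<le> ratio (Suc k)"
  using ratio_bounds(2)[of k] by (simp add: ratio_Suc)

lemma ratio_variation: "\<bar>ratio (Suc k) - ratio k\<bar> \<le> 1 / T (Suc k)"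
  using ratio_bounds[of k] e_nonneg[of k] e_le_1[of k]
  by (simp add: ratio_Suc abs_divide divide_right_mono)

text \<open>The ratio moves by \<open>(e - ratio) / T\<close>, so up to squared steps the difference of the two sums
  telescopes along a primitive of \<open>\<lambda>v. b + c * v\<close>.\<close>

lemma affine_occupation_le:
  assumes c: "0 \<le> c"
  shows "(\<Sum>k<n. (b + c * ratio k) * (ratio k / T (Suc k)))
    \<le> (\<Sum>k<n. (b + c * ratio k) * (e k / T (Suc k))) + 2 * (\<bar>b\<bar> + c)"
    (is "?occupation \<le> ?visits + _")
proof -
  define F where "F v = b * v + c / 2 * v\<^sup>2" for v
  have step: "(b + c * ratio k) * (ratio k / T (Suc k)) - (b + c * ratio k) * (e k / T (Suc k))
    \<le> F (ratio k) - F (ratio (Suc k)) + c / 2 * (1 / T (Suc k))\<^sup>2" for k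
  proof -
    define \<delta> where "\<delta> = (e k - ratio k) / T (Suc k)"
    have "F (ratio k + \<delta>) = F (ratio k) + (b + c * ratio k) * \<delta> + c / 2 * \<delta>\<^sup>2"
      by (simp add: F_def algebra_simps power2_eq_square add_divide_distrib)
    moreover have "\<delta>\<^sup>2 \<le> (1 / T (Suc k))\<^sup>2"
      using ratio_variation[of k]
      by (simp add: \<delta>_def ratio_Suc abs_le_square_iff[symmetric])
    then have "c / 2 * \<delta>\<^sup>2 \<le> c / 2 * (1 / T (Suc k))\<^sup>2" using c by (intro mult_left_mono) auto
    ultimately show ?thesis
      unfolding ratio_Suc \<delta>_def[symmetric] by (simp add: \<delta>_def diff_divide_distrib algebra_simps)
  qed
  have range: "0 \<le> c / 2 * (ratio k)\<^sup>2" "c / 2 * (ratio k)\<^sup>2 \<le> c / 2" "\<bar>b * ratio k\<bar> \<le> \<bar>b\<bar>" for k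
    using c ratio_bounds[of k] by (auto simp: abs_mult power_le_one mult_left_le)
  have "?occupation - ?visits
      \<le> (\<Sum>k<n. F (ratio k) - F (ratio (Suc k)) + c / 2 * (1 / T (Suc k))\<^sup>2)"
    unfolding sum_subtractf[symmetric] by (intro sum_mono step)
  also have "\<dots> = F (ratio 0) - F (ratio n) + c / 2 * (\<Sum>k<n. (1 / T (Suc k))\<^sup>2)"
    unfolding sum.distrib sum_lessThan_telescope'[of "\<lambda>k. F (ratio k)"] sum_distrib_left ..
  finally have "?occupation - ?visits
      \<le> F (ratio 0) - F (ratio n) + c / 2 * (\<Sum>k<n. (1 / T (Suc k))\<^sup>2)" .
  moreover have "c / 2 * (\<Sum>k<n. (1 / T (Suc k))\<^sup>2) \<le> c / 2 * 2"
    using sum_inverse_T_squared_le c by (intro mult_left_mono) auto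
  moreover have "F (ratio 0) - F (ratio n) \<le> 2 * \<bar>b\<bar> + c / 2"
    using range[of 0] range[of n] unfolding F_def by linarith
  ultimately show ?thesis using c by simp
qed

lemma tendsto_if_summable_square_deviation:
  assumes a: "0 \<le> a" "a \<le> 1" and deviation: "summable (\<lambda>k. (ratio k - a)\<^sup>2 / T (Suc k))"
  shows "ratio \<longlonglongrightarrow> a"
proof -
  have slow: "\<bar>(ratio (Suc k) - a)\<^sup>2 - (ratio k - a)\<^sup>2\<bar> \<le> 2 * (1 / T (Suc k))" for k
  proof -
    have "\<bar>(ratio (Suc k) - a)\<^sup>2 - (ratio k - a)\<^sup>2\<bar>
        = \<bar>ratio (Suc k) + ratio k - 2 * a\<bar> * \<bar>ratio (Suc k) - ratio k\<bar>"
      unfolding abs_mult[symmetric] by (simp add: power2_eq_square algebra_simps)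
    also have "\<dots> \<le> 2 * (1 / T (Suc k))"
      using ratio_bounds[of k] ratio_bounds[of "Suc k"] a by (intro mult_mono ratio_variation) auto
    finally show ?thesis .
  qed
  have "(\<lambda>k. (ratio k - a)\<^sup>2) \<longlonglongrightarrow> 0"
    using deviation slow
    by (intro tendsto_zero_if_slowly_varying[where a = "\<lambda>k. 1 / T (Suc k)" and c = 2])
      (auto simp: not_summable_inverse_T summable_inverse_T_squared)
  then show ?thesis by (simp add: LIM_zero_iff)
qed

end

lemma tangent_le_inverse:
  fixes s v :: real
  assumes "0 < s" "0 < v"
  shows "2 / s - v / s\<^sup>2 \<le> 1 / v"
proof -
  have "1 / v - (2 / s - v / s\<^sup>2) = (v - s)\<^sup>2 / (v * s\<^sup>2)"
    using assms by (simp add: divide_simps) (simp add: algebra_simps power2_eq_square)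
  also have "\<dots> \<ge> 0" using assms by simp
  finally show ?thesis by simp
qed

section \<open>Martingale differences\<close>

locale filtered_prob_space = prob_space M + filtration "space M" F
  for M :: "'w measure" and F :: "nat \<Rightarrow> 'w measure" +
  assumes sets_F_subset: "sets (F n) \<subseteq> sets M"
begin

lemma subalgebra_F: "subalgebra M (F n)"
  by (simp add: subalgebra_def space_F sets_F_subset)

sublocale cond: finite_measure_subalgebra M "F n" for n
  by unfold_locales (rule subalgebra_F)

lemma measurable_F_mono: "f \<in> measurable (F m) N \<Longrightarrow> m \<le> n \<Longrightarrow> f \<in> measurable (F n) N"
  using sets_F_mono[of m n] space_F by (auto simp: measurable_def)

lemma measurable_F_imp_measurable: "f \<in> measurable (F m) N \<Longrightarrow> f \<in> measurable M N"
  by (rule measurable_from_subalg[OF subalgebra_F])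

end

lemma integrable_mult_if_square_integrable:
  fixes f g :: "'w \<Rightarrow> real"
  assumes [measurable]: "f \<in> borel_measurable M" "g \<in> borel_measurable M"
    and squares: "integrable M (\<lambda>\<omega>. (f \<omega>)\<^sup>2)" "integrable M (\<lambda>\<omega>. (g \<omega>)\<^sup>2)"
  shows "integrable M (\<lambda>\<omega>. f \<omega> * g \<omega>)"
proof (rule Bochner_Integration.integrable_bound)
  show "integrable M (\<lambda>\<omega>. (f \<omega>)\<^sup>2 + (g \<omega>)\<^sup>2)" using squares by simp
  have "\<bar>a * b\<bar> \<le> a\<^sup>2 + b\<^sup>2" for a b :: real
    using sum_squares_bound[of "\<bar>a\<bar>" "\<bar>b\<bar>"] mult_nonneg_nonneg[of "\<bar>a\<bar>" "\<bar>b\<bar>"]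
    unfolding abs_mult power2_abs by linarith
  then show "AE \<omega> in M. norm (f \<omega> * g \<omega>) \<le> norm ((f \<omega>)\<^sup>2 + (g \<omega>)\<^sup>2)" by simp
qed simp

locale martingale_differences = filtered_prob_space +
  fixes D :: "nat \<Rightarrow> 'a \<Rightarrow> real"
  assumes D_measurable_F: "D k \<in> borel_measurable (F (Suc k))"
    and D_square_integrable: "integrable M (\<lambda>\<omega>. (D k \<omega>)\<^sup>2)"
    and cond_exp_D: "AE \<omega> in M. real_cond_exp M (F k) (D k) \<omega> = 0"
begin

lemma D_measurable [measurable]: "D k \<in> borel_measurable M"
  by (rule measurable_F_imp_measurable[OF D_measurable_F])

lemma expectation_mult_D:
  assumes f: "f \<in> borel_measurable (F k)" "integrable M (\<lambda>\<omega>. (f \<omega>)\<^sup>2)"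
  shows "expectation (\<lambda>\<omega>. f \<omega> * D k \<omega>) = 0"
proof -
  have [measurable]: "f \<in> borel_measurable M" by (rule measurable_F_imp_measurable[OF f(1)])
  have "integrable M (\<lambda>\<omega>. f \<omega> * D k \<omega>)"
    using f D_square_integrable by (intro integrable_mult_if_square_integrable) auto
  then have "expectation (\<lambda>\<omega>. f \<omega> * D k \<omega>) = expectation (\<lambda>\<omega>. f \<omega> * real_cond_exp M (F k) (D k) \<omega>)"
    using f(1) by (intro cond.real_cond_exp_intg(2)[symmetric]) auto
  also have "\<dots> = expectation (\<lambda>_. 0)"
    using cond_exp_D[of k] by (intro integral_cong_AE) auto
  finally show ?thesis by simp
qed

definition S :: "nat \<Rightarrow> 'a \<Rightarrow> real" where "S n \<omega> = (\<Sum>k<n. D k \<omega>)"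

lemma S_measurable_F: "S n \<in> borel_measurable (F n)"
  unfolding S_def by (intro borel_measurable_sum measurable_F_mono[OF D_measurable_F]) auto

lemma S_measurable [measurable]: "S n \<in> borel_measurable M"
  by (rule measurable_F_imp_measurable[OF S_measurable_F])

lemma
  shows S_square_integrable: "integrable M (\<lambda>\<omega>. (S n \<omega>)\<^sup>2)"
    and second_moment_S: "expectation (\<lambda>\<omega>. (S n \<omega>)\<^sup>2) = (\<Sum>k<n. expectation (\<lambda>\<omega>. (D k \<omega>)\<^sup>2))"
proof (induction n)
  case 0
  show "integrable M (\<lambda>\<omega>. (S 0 \<omega>)\<^sup>2)" by (simp add: S_def)
  show "expectation (\<lambda>\<omega>. (S 0 \<omega>)\<^sup>2) = (\<Sum>k<0. expectation (\<lambda>\<omega>. (D k \<omega>)\<^sup>2))" by (simp add: S_def)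
next
  case (Suc n)
  have expand: "(S (Suc n) \<omega>)\<^sup>2 = (S n \<omega>)\<^sup>2 + 2 * (S n \<omega> * D n \<omega>) + (D n \<omega>)\<^sup>2" for \<omega>
    by (simp add: S_def power2_sum)
  have cross: "integrable M (\<lambda>\<omega>. S n \<omega> * D n \<omega>)"
    by (intro integrable_mult_if_square_integrable Suc.IH D_square_integrable) auto
  show "integrable M (\<lambda>\<omega>. (S (Suc n) \<omega>)\<^sup>2)"
    unfolding expand using Suc.IH(1) cross D_square_integrable by simp
  show "expectation (\<lambda>\<omega>. (S (Suc n) \<omega>)\<^sup>2) = (\<Sum>k<Suc n. expectation (\<lambda>\<omega>. (D k \<omega>)\<^sup>2))"
    unfolding expand using Suc.IH cross D_square_integrable
    by (simp add: expectation_mult_D[OF S_measurable_F Suc.IH(1)])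
qed

end

lemma (in martingale_differences) martingale_differences_predictable_selection:
  assumes P: "\<And>k. Measurable.pred (F k) (P k)"
  shows "martingale_differences M F (\<lambda>k \<omega>. of_bool (P k \<omega>) * D k \<omega>)"
    (is "martingale_differences M F ?D")
proof
  fix k
  have [measurable]: "Measurable.pred (F (Suc k)) (P k)" by (rule measurable_F_mono[OF P]) simp
  note [measurable] = D_measurable_F P
  show selected_F: "?D k \<in> borel_measurable (F (Suc k))" by measurable
  note [measurable] = measurable_F_imp_measurable[OF selected_F]
  show "integrable M (\<lambda>\<omega>. (?D k \<omega>)\<^sup>2)"
    by (rule Bochner_Integration.integrable_bound[OF D_square_integrable[of k]]) auto
  then have "integrable M (?D k)"
    by (rule square_integrable_imp_integrable[rotated]) measurable
  then have "AE \<omega> in M. real_cond_exp M (F k) (?D k) \<omega>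
      = of_bool (P k \<omega>) * real_cond_exp M (F k) (D k) \<omega>"
    by (intro cond.real_cond_exp_mult) measurable
  with cond_exp_D[of k] show "AE \<omega> in M. real_cond_exp M (F k) (?D k) \<omega> = 0"
    by eventually_elim simp
qed

text \<open>Freezing the partial sums when they first reach \<open>K\<close> selects the differences predictably, so
  that the second moment method for the frozen sum controls the maximum.\<close>

lemma (in martingale_differences) maximal_inequality:
  assumes K: "0 < K"
  shows "prob {\<omega> \<in> space M. \<exists>j\<le>n. K \<le> \<bar>S j \<omega>\<bar>} \<le> (\<Sum>k<n. expectation (\<lambda>\<omega>. (D k \<omega>)\<^sup>2)) / K\<^sup>2"
proof -
  define active where "active k \<omega> \<longleftrightarrow> (\<forall>j\<in>{..k}. \<bar>S j \<omega>\<bar> < K)" for k \<omega>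
  interpret frozen: martingale_differences M F "\<lambda>k \<omega>. of_bool (active k \<omega>) * D k \<omega>"
  proof (rule martingale_differences_predictable_selection)
    fix k
    have [measurable]: "S j \<in> borel_measurable (F k)" if "j \<in> {..k}" for j
      using that by (intro measurable_F_mono[OF S_measurable_F]) auto
    show "Measurable.pred (F k) (active k)" unfolding active_def by measurable
  qed
  have reached: "K \<le> \<bar>frozen.S n \<omega>\<bar>" if reach: "\<exists>j\<le>n. K \<le> \<bar>S j \<omega>\<bar>" for \<omega>
  proof -
    define j where "j = (LEAST j. K \<le> \<bar>S j \<omega>\<bar>)"
    have j: "K \<le> \<bar>S j \<omega>\<bar>" "j \<le> n"
      unfolding j_def using reach by (metis (mono_tags, lifting) LeastI Least_le le_trans)+
    have before: "\<bar>S i \<omega>\<bar> < K" if "i < j" for i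
      using not_less_Least[OF that[unfolded j_def]] by simp
    have "active k \<omega> \<longleftrightarrow> k < j" for k
      using j(1) before unfolding active_def by (meson atMost_iff le_less_trans not_le)
    then have "frozen.S n \<omega> = (\<Sum>k<n. of_bool (k < j) * D k \<omega>)"
      by (simp add: frozen.S_def)
    also have "\<dots> = S j \<omega>"
      unfolding S_def using j(2) by (intro sum.mono_neutral_cong_right) auto
    finally show ?thesis using j by simp
  qed
  have "prob {\<omega> \<in> space M. \<exists>j\<le>n. K \<le> \<bar>S j \<omega>\<bar>} \<le> prob {\<omega> \<in> space M. K \<le> \<bar>frozen.S n \<omega>\<bar>}"
    using reached by (intro finite_measure_mono) auto
  also have "\<dots> \<le> (\<Sum>k<n. expectation (\<lambda>\<omega>. (of_bool (active k \<omega>) * D k \<omega>)\<^sup>2)) / K\<^sup>2"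
    unfolding frozen.second_moment_S[symmetric]
    by (rule second_moment_method[OF _ frozen.S_square_integrable K]) simp
  also have "\<dots> \<le> (\<Sum>k<n. expectation (\<lambda>\<omega>. (D k \<omega>)\<^sup>2)) / K\<^sup>2"
    by (intro divide_right_mono sum_mono integral_mono frozen.D_square_integrable
        D_square_integrable) auto
  finally show ?thesis .
qed

context martingale_differences
begin

lemma martingale_differences_shift: "martingale_differences M (\<lambda>n. F (m + n)) (\<lambda>k. D (m + k))"
  using D_measurable_F D_square_integrable cond_exp_D sets_F_subset sets_F_mono space_F
  by unfold_locales simp_all

lemma prob_tail_deviation_le:
  assumes summable_variance: "summable (\<lambda>k. expectation (\<lambda>\<omega>. (D k \<omega>)\<^sup>2))" and K: "0 < K"
  shows "prob {\<omega> \<in> space M. \<exists>j. K \<le> \<bar>S (m + j) \<omega> - S m \<omega>\<bar>}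
    \<le> (\<Sum>k. expectation (\<lambda>\<omega>. (D (m + k) \<omega>)\<^sup>2)) / K\<^sup>2"
proof -
  interpret tail: martingale_differences M "\<lambda>n. F (m + n)" "\<lambda>k. D (m + k)"
    by (rule martingale_differences_shift)
  have tail_S: "tail.S j \<omega> = S (m + j) \<omega> - S m \<omega>" for j \<omega>
    unfolding tail.S_def S_def by (induction j) auto
  define E where "E n = {\<omega> \<in> space M. \<exists>j\<in>{..n}. K \<le> \<bar>tail.S j \<omega>\<bar>}" for n
  have [measurable]: "E n \<in> sets M" for n unfolding E_def by measurable
  have "prob (E n) \<le> (\<Sum>k. expectation (\<lambda>\<omega>. (D (m + k) \<omega>)\<^sup>2)) / K\<^sup>2" for n
  proof -
    have "prob (E n) \<le> (\<Sum>k<n. expectation (\<lambda>\<omega>. (D (m + k) \<omega>)\<^sup>2)) / K\<^sup>2"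
      using tail.maximal_inequality[OF K, of n] by (simp add: E_def Bex_def)
    also have "\<dots> \<le> (\<Sum>k. expectation (\<lambda>\<omega>. (D (m + k) \<omega>)\<^sup>2)) / K\<^sup>2"
      using summable_variance
      by (intro divide_right_mono sum_le_suminf)
        (auto simp: add.commute[of m] intro: summable_ignore_initial_segment)
    finally show ?thesis .
  qed
  moreover have "(\<lambda>n. prob (E n)) \<longlonglongrightarrow> prob (\<Union>n. E n)"
    by (intro finite_Lim_measure_incseq) (auto simp: incseq_def E_def)
  ultimately have "prob (\<Union>n. E n) \<le> (\<Sum>k. expectation (\<lambda>\<omega>. (D (m + k) \<omega>)\<^sup>2)) / K\<^sup>2"
    by (intro LIMSEQ_le_const2) auto
  also have "(\<Union>n. E n) = {\<omega> \<in> space M. \<exists>j. K \<le> \<bar>S (m + j) \<omega> - S m \<omega>\<bar>}"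
    by (auto simp: E_def tail_S)
  finally show ?thesis .
qed

lemma AE_tail_deviation_less:
  assumes summable_variance: "summable (\<lambda>k. expectation (\<lambda>\<omega>. (D k \<omega>)\<^sup>2))" and K: "0 < K"
  shows "AE \<omega> in M. \<exists>m. \<forall>j. \<bar>S (m + j) \<omega> - S m \<omega>\<bar> < K"
proof -
  define B where "B = {\<omega> \<in> space M. \<forall>m. \<exists>j. K \<le> \<bar>S (m + j) \<omega> - S m \<omega>\<bar>}"
  have [measurable]: "B \<in> sets M" unfolding B_def by measurable
  have "prob B \<le> (\<Sum>k. expectation (\<lambda>\<omega>. (D (k + m) \<omega>)\<^sup>2)) / K\<^sup>2" for m
  proof -
    have "prob B \<le> prob {\<omega> \<in> space M. \<exists>j. K \<le> \<bar>S (m + j) \<omega> - S m \<omega>\<bar>}"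
      by (rule finite_measure_mono) (auto simp: B_def)
    then show ?thesis
      using prob_tail_deviation_le[OF summable_variance K, of m] by (simp add: add.commute)
  qed
  moreover have "(\<lambda>m. (\<Sum>k. expectation (\<lambda>\<omega>. (D (k + m) \<omega>)\<^sup>2)) / K\<^sup>2) \<longlonglongrightarrow> 0 / K\<^sup>2"
    using K summable_variance by (intro tendsto_divide suminf_exist_split2) auto
  ultimately have "prob B \<le> 0" by (intro LIMSEQ_le_const) auto
  then have "B \<in> null_sets M" by (auto simp: null_sets_def emeasure_eq_measure measure_le_0_iff)
  then show ?thesis by (rule AE_I') (auto simp: B_def not_less)
qed

theorem AE_summable:
  assumes summable_variance: "summable (\<lambda>k. expectation (\<lambda>\<omega>. (D k \<omega>)\<^sup>2))"
  shows "AE \<omega> in M. summable (\<lambda>k. D k \<omega>)"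
proof -
  have "AE \<omega> in M. \<forall>i. \<exists>m. \<forall>j. \<bar>S (m + j) \<omega> - S m \<omega>\<bar> < inverse (real (Suc i))"
    unfolding AE_all_countable using AE_tail_deviation_less[OF summable_variance] by simp
  then show ?thesis
  proof eventually_elim
    case (elim \<omega>)
    have "Cauchy (\<lambda>n. S n \<omega>)"
    proof (rule metric_CauchyI)
      fix \<epsilon> :: real assume "0 < \<epsilon>"
      then obtain i where i: "inverse (real (Suc i)) < \<epsilon> / 2"
        using reals_Archimedean[of "\<epsilon> / 2"] by auto
      obtain m where m: "\<bar>S (m + j) \<omega> - S m \<omega>\<bar> < \<epsilon> / 2" for j
        using elim i by (meson less_trans)
      have near: "\<bar>S a \<omega> - S m \<omega>\<bar> < \<epsilon> / 2" if "m \<le> a" for a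
        using m[of "a - m"] that by simp
      have "dist (S a \<omega>) (S b \<omega>) < \<epsilon>" if "m \<le> a" "m \<le> b" for a b
        using near[OF that(1)] near[OF that(2)] unfolding dist_real_def by linarith
      then show "\<exists>m. \<forall>a\<ge>m. \<forall>b\<ge>m. dist (S a \<omega>) (S b \<omega>) < \<epsilon>" by blast
    qed
    then show ?case by (simp add: summable_iff_convergent Cauchy_convergent_iff S_def)
  qed
qed

end

context filtered_prob_space
begin

definition cond_prob :: "nat \<Rightarrow> 'w set \<Rightarrow> 'w \<Rightarrow> real" where
  "cond_prob k A = real_cond_exp M (F k) (indicator A)"

definition compensated :: "nat \<Rightarrow> 'w set \<Rightarrow> ('w \<Rightarrow> real) \<Rightarrow> 'w \<Rightarrow> real" where
  "compensated k A g \<omega> = g \<omega> * (indicator A \<omega> - cond_prob k A \<omega>)"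

lemma cond_prob_measurable_F: "cond_prob k A \<in> borel_measurable (F k)"
  by (simp add: cond_prob_def)

lemma cond_prob_measurable [measurable]: "cond_prob k A \<in> borel_measurable M"
  by (simp add: cond_prob_def)

context
  fixes k :: nat and A :: "'w set" and g :: "'w \<Rightarrow> real"
  assumes A: "A \<in> sets (F (Suc k))" and g: "g \<in> borel_measurable (F k)"
    and integrable_square_on_A: "integrable M (\<lambda>\<omega>. (g \<omega>)\<^sup>2 * indicator A \<omega>)"
begin

lemma event_and_coefficient_measurable: "A \<in> sets M" "g \<in> borel_measurable M"
  using A sets_F_subset measurable_F_imp_measurable[OF g] by auto

lemma integrable_indicator_A: "integrable M (indicator A :: 'w \<Rightarrow> real)"
  using event_and_coefficient_measurable(1) by (simp add: emeasure_eq_measure)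

lemma cond_prob_bounds: "AE \<omega> in M. 0 \<le> cond_prob k A \<omega> \<and> cond_prob k A \<omega> \<le> 1"
proof -
  note [measurable] = event_and_coefficient_measurable
  have nonneg: "AE \<omega> in M. 0 \<le> cond_prob k A \<omega>"
    unfolding cond_prob_def by (intro cond.real_cond_exp_pos) auto
  have mono: "AE \<omega> in M. cond_prob k A \<omega> \<le> real_cond_exp M (F k) (\<lambda>_. 1) \<omega>"
    unfolding cond_prob_def
    by (intro cond.real_cond_exp_mono integrable_indicator_A) (auto simp: indicator_def)
  have one: "AE \<omega> in M. real_cond_exp M (F k) (\<lambda>_. 1) \<omega> = 1"
    by (intro cond.real_cond_exp_F_meas) auto
  from nonneg mono one show ?thesis by eventually_elim simp
qed

lemma compensated_measurable_F: "compensated k A g \<in> borel_measurable (F (Suc k))"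
proof -
  note [measurable] = A measurable_F_mono[OF g, of "Suc k", simplified]
    measurable_F_mono[OF cond_prob_measurable_F, of k "Suc k", simplified]
  show ?thesis unfolding compensated_def[abs_def] by measurable
qed

lemma
  shows integrable_square_mult_cond_prob: "integrable M (\<lambda>\<omega>. (g \<omega>)\<^sup>2 * cond_prob k A \<omega>)"
    and expectation_square_mult_cond_prob:
      "expectation (\<lambda>\<omega>. (g \<omega>)\<^sup>2 * cond_prob k A \<omega>) = expectation (\<lambda>\<omega>. (g \<omega>)\<^sup>2 * indicator A \<omega>)"
proof -
  note [measurable] = g event_and_coefficient_measurable
  have "(\<lambda>\<omega>. (g \<omega>)\<^sup>2) \<in> borel_measurable (F k)" by measurable
  from cond.real_cond_exp_intg[OF integrable_square_on_A this]
  show "integrable M (\<lambda>\<omega>. (g \<omega>)\<^sup>2 * cond_prob k A \<omega>)"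
    "expectation (\<lambda>\<omega>. (g \<omega>)\<^sup>2 * cond_prob k A \<omega>) = expectation (\<lambda>\<omega>. (g \<omega>)\<^sup>2 * indicator A \<omega>)"
    unfolding cond_prob_def by simp_all
qed

lemma compensated_square_le:
  "AE \<omega> in M. (compensated k A g \<omega>)\<^sup>2 \<le> (g \<omega>)\<^sup>2 * indicator A \<omega> + (g \<omega>)\<^sup>2 * cond_prob k A \<omega>"
  using cond_prob_bounds
proof eventually_elim
  case (elim \<omega>)
  then have "(indicator A \<omega> - cond_prob k A \<omega>)\<^sup>2 \<le> indicator A \<omega> + cond_prob k A \<omega>"
    using mult_left_le[of "cond_prob k A \<omega>" "cond_prob k A \<omega>"]
    by (cases "\<omega> \<in> A") (auto simp: power2_eq_square algebra_simps)
  then have "(g \<omega>)\<^sup>2 * (indicator A \<omega> - cond_prob k A \<omega>)\<^sup>2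
      \<le> (g \<omega>)\<^sup>2 * (indicator A \<omega> + cond_prob k A \<omega>)"
    by (rule mult_left_mono) simp
  then show ?case by (simp add: compensated_def power_mult_distrib distrib_left)
qed

lemma compensated_square_integrable: "integrable M (\<lambda>\<omega>. (compensated k A g \<omega>)\<^sup>2)"
proof (rule Bochner_Integration.integrable_bound)
  note [measurable] = measurable_F_imp_measurable[OF compensated_measurable_F]
  show "(\<lambda>\<omega>. (compensated k A g \<omega>)\<^sup>2) \<in> borel_measurable M" by measurable
  show "integrable M (\<lambda>\<omega>. (g \<omega>)\<^sup>2 * indicator A \<omega> + (g \<omega>)\<^sup>2 * cond_prob k A \<omega>)"
    using integrable_square_on_A integrable_square_mult_cond_prob by simp
  show "AE \<omega> in M. norm ((compensated k A g \<omega>)\<^sup>2)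
      \<le> norm ((g \<omega>)\<^sup>2 * indicator A \<omega> + (g \<omega>)\<^sup>2 * cond_prob k A \<omega>)"
    using compensated_square_le by eventually_elim simp
qed

lemma compensated_second_moment_le:
  "expectation (\<lambda>\<omega>. (compensated k A g \<omega>)\<^sup>2) \<le> 2 * expectation (\<lambda>\<omega>. (g \<omega>)\<^sup>2 * indicator A \<omega>)"
proof -
  note integrable = compensated_square_integrable integrable_square_on_A
    integrable_square_mult_cond_prob
  have "expectation (\<lambda>\<omega>. (compensated k A g \<omega>)\<^sup>2)
      \<le> expectation (\<lambda>\<omega>. (g \<omega>)\<^sup>2 * indicator A \<omega> + (g \<omega>)\<^sup>2 * cond_prob k A \<omega>)"
    by (intro integral_mono_AE compensated_square_le Bochner_Integration.integrable_add integrable)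
  then show ?thesis using integrable by (simp add: expectation_square_mult_cond_prob)
qed

lemma cond_exp_compensated: "AE \<omega> in M. real_cond_exp M (F k) (compensated k A g) \<omega> = 0"
proof -
  note [measurable] = event_and_coefficient_measurable
  have integrable_cond_prob: "integrable M (cond_prob k A)"
    unfolding cond_prob_def by (intro cond.real_cond_exp_int integrable_indicator_A)
  have "integrable M (compensated k A g)"
    using measurable_F_imp_measurable[OF compensated_measurable_F] compensated_square_integrable
    by (rule square_integrable_imp_integrable)
  then have pull_out: "AE \<omega> in M. real_cond_exp M (F k) (compensated k A g) \<omega>
      = g \<omega> * real_cond_exp M (F k) (\<lambda>\<omega>. indicator A \<omega> - cond_prob k A \<omega>) \<omega>"
    unfolding compensated_def[abs_def] by (intro cond.real_cond_exp_mult[OF g]) measurable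
  have diff: "AE \<omega> in M. real_cond_exp M (F k) (\<lambda>\<omega>. indicator A \<omega> - cond_prob k A \<omega>) \<omega>
      = real_cond_exp M (F k) (indicator A) \<omega> - real_cond_exp M (F k) (cond_prob k A) \<omega>"
    by (rule cond.real_cond_exp_diff[OF integrable_indicator_A integrable_cond_prob])
  have idem: "AE \<omega> in M. real_cond_exp M (F k) (cond_prob k A) \<omega> = cond_prob k A \<omega>"
    by (rule cond.real_cond_exp_F_meas[OF integrable_cond_prob cond_prob_measurable_F])
  from pull_out diff idem show ?thesis by eventually_elim (simp add: cond_prob_def)
qed

end

lemma integrable_if_AE_bounded_partial_sums:
  fixes f :: "nat \<Rightarrow> 'w \<Rightarrow> real"
  assumes f: "\<And>k. f k \<in> borel_measurable M" "\<And>k \<omega>. 0 \<le> f k \<omega>"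
    and bounded: "AE \<omega> in M. \<forall>n. (\<Sum>k<n. f k \<omega>) \<le> C"
  shows "integrable M (f k)"
proof (rule integrable_const_bound)
  show "AE \<omega> in M. norm (f k \<omega>) \<le> C"
    using bounded
  proof eventually_elim
    case (elim \<omega>)
    have "f k \<omega> \<le> (\<Sum>k<Suc k. f k \<omega>)"
      using f(2) by (intro member_le_sum) auto
    also have "\<dots> \<le> C" using elim by blast
    finally show ?case using f(2) by simp
  qed
qed (rule f)

theorem AE_summable_compensated:
  fixes A :: "nat \<Rightarrow> 'w set" and g :: "nat \<Rightarrow> 'w \<Rightarrow> real"
  assumes A: "\<And>k. A k \<in> sets (F (Suc k))" and g: "\<And>k. g k \<in> borel_measurable (F k)"
    and bounded: "AE \<omega> in M. \<forall>n. (\<Sum>k<n. (g k \<omega>)\<^sup>2 * indicator (A k) \<omega>) \<le> C"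
  shows "AE \<omega> in M. summable (\<lambda>k. compensated k (A k) (g k) \<omega>)"
proof -
  have [measurable]: "A k \<in> sets M" for k using A sets_F_subset by blast
  have [measurable]: "g k \<in> borel_measurable M" for k using g by (rule measurable_F_imp_measurable)
  have integrable: "integrable M (\<lambda>\<omega>. (g k \<omega>)\<^sup>2 * indicator (A k) \<omega>)" for k
    by (rule integrable_if_AE_bounded_partial_sums[OF _ _ bounded]) auto
  interpret martingale_differences M F "\<lambda>k. compensated k (A k) (g k)"
    by unfold_locales (rule compensated_measurable_F[OF A g integrable]
        compensated_square_integrable[OF A g integrable] cond_exp_compensated[OF A g integrable])+
  have "summable (\<lambda>k. expectation (\<lambda>\<omega>. (compensated k (A k) (g k) \<omega>)\<^sup>2))"
  proof (rule summableI_nonneg_bounded)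
    fix n
    have "(\<Sum>k<n. expectation (\<lambda>\<omega>. (compensated k (A k) (g k) \<omega>)\<^sup>2))
        \<le> (\<Sum>k<n. 2 * expectation (\<lambda>\<omega>. (g k \<omega>)\<^sup>2 * indicator (A k) \<omega>))"
      by (intro sum_mono compensated_second_moment_le[OF A g integrable])
    also have "\<dots> = 2 * expectation (\<lambda>\<omega>. \<Sum>k<n. (g k \<omega>)\<^sup>2 * indicator (A k) \<omega>)"
      by (simp only: Bochner_Integration.integral_sum[OF integrable] sum_distrib_left)
    also have "\<dots> \<le> 2 * expectation (\<lambda>_. C)"
      using bounded
      by (intro mult_left_mono integral_mono_AE Bochner_Integration.integrable_sum integrable) auto
    finally show "(\<Sum>k<n. expectation (\<lambda>\<omega>. (compensated k (A k) (g k) \<omega>)\<^sup>2)) \<le> 2 * C"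
      by (simp add: prob_space)
  qed simp
  then show ?thesis by (rule AE_summable)
qed

end

section \<open>Processes with prescribed transition probabilities\<close>

definition history :: "(nat \<Rightarrow> 's) \<Rightarrow> nat \<Rightarrow> 's list" where
  "history x n = map x [0..<Suc n]"

lemma history_not_Nil [simp]: "history x n \<noteq> []"
  by (simp add: history_def)

lemma history_Suc: "history x (Suc n) = history x n @ [x (Suc n)]"
  by (simp add: history_def)

lemma last_history [simp]: "last (history x n) = x n"
  by (simp add: history_def)

lemma take_history: "m \<le> n \<Longrightarrow> take (Suc m) (history x n) = history x m"
  unfolding history_def take_map take_upt by (simp add: take_upt del: upt_Suc)

lemma history_eq_iff: "history x n = h \<longleftrightarrow> length h = Suc n \<and> (\<forall>s\<le>n. x s = h ! s)"
  by (auto simp: history_def list_eq_iff_nth_eq less_Suc_eq_le simp del: upt_Suc)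

lemma emeasure_distr_density_indicator:
  assumes [measurable]: "E \<in> sets M" "f \<in> measurable M N" "B \<in> sets N"
  shows "emeasure (distr (density M (indicator E)) N f) B = emeasure M (E \<inter> (f -` B \<inter> space M))"
proof -
  have "emeasure (distr (density M (indicator E)) N f) B
      = emeasure (density M (indicator E)) (f -` B \<inter> space M)"
    by (subst emeasure_distr) auto
  also have "\<dots> = emeasure M (E \<inter> (f -` B \<inter> space M))"
    by (subst emeasure_density)
      (auto simp: nn_integral_indicator[symmetric] indicator_inter_arith)
  finally show ?thesis .
qed

locale history_process = prob_space M for M :: "'w measure" +
  fixes X :: "nat \<Rightarrow> 'w \<Rightarrow> 's :: countable" and p :: "'s list \<Rightarrow> 's \<Rightarrow> real"
  assumes X_measurable [measurable]: "X n \<in> measurable M (count_space UNIV)"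
    and p_bounds: "0 \<le> p h w" "p h w \<le> 1"
    and transition: "length h = Suc n \<Longrightarrow>
      prob {\<omega> \<in> space M. (\<forall>s\<le>n. X s \<omega> = h ! s) \<and> X (Suc n) \<omega> = w}
      = prob {\<omega> \<in> space M. \<forall>s\<le>n. X s \<omega> = h ! s} * p h w"
begin

abbreviation trajectory :: "'w \<Rightarrow> nat \<Rightarrow> 's" where "trajectory \<omega> \<equiv> (\<lambda>n. X n \<omega>)"

abbreviation past :: "nat \<Rightarrow> 'w \<Rightarrow> 's list" where "past n \<omega> \<equiv> history (trajectory \<omega>) n"

lemma past_measurable [measurable]: "past n \<in> measurable M (count_space UNIV)"
proof (subst measurable_count_space_eq2_countable, safe)
  fix h
  have "past n -` {h} \<inter> space M
      = {\<omega> \<in> space M. length h = Suc n \<and> (\<forall>s\<in>{..n}. X s \<omega> = h ! s)}"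
    unfolding vimage_def Int_def by (simp add: history_eq_iff Ball_def conj_commute)
  also have "\<dots> \<in> sets M" by measurable
  finally show "past n -` {h} \<inter> space M \<in> sets M" .
qed auto

lemma prob_past_Suc:
  "prob {\<omega> \<in> space M. past n \<omega> = h \<and> X (Suc n) \<omega> = w}
   = prob {\<omega> \<in> space M. past n \<omega> = h} * p h w"
  using transition by (cases "length h = Suc n") (simp_all add: history_eq_iff)

lemma AE_transition_positive: "AE \<omega> in M. \<forall>n. 0 < p (past n \<omega>) (X (Suc n) \<omega>)"
proof -
  have "AE \<omega> in M. \<not> (past n \<omega> = h \<and> X (Suc n) \<omega> = w)" if "p h w = 0" for n h w
    using prob_past_Suc[of n h w] that
    by (intro AE_I'[of "{\<omega> \<in> space M. past n \<omega> = h \<and> X (Suc n) \<omega> = w}"])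
      (auto simp: null_sets_def emeasure_eq_measure)
  then have "AE \<omega> in M. \<forall>n h w. p h w = 0 \<longrightarrow> \<not> (past n \<omega> = h \<and> X (Suc n) \<omega> = w)"
    unfolding AE_all_countable by auto
  then show ?thesis by eventually_elim (metis order_le_less p_bounds(1))
qed

definition natural_filtration :: "nat \<Rightarrow> 'w measure" where
  "natural_filtration n = vimage_algebra (space M) (past n) (count_space UNIV)"

lemma sets_natural_filtration:
  "sets (natural_filtration n) = {{\<omega> \<in> space M. past n \<omega> \<in> B} | B. True}"
  unfolding natural_filtration_def
  by (subst sets_vimage_algebra2) (auto simp: vimage_def Int_def conj_commute)

sublocale filtered_prob_space M natural_filtration
proof
  show "space (natural_filtration n) = space M" for n by (simp add: natural_filtration_def)
  show "sets (natural_filtration n) \<subseteq> sets M" for n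
    unfolding sets_natural_filtration by auto
  show "sets (natural_filtration m) \<subseteq> sets (natural_filtration n)" if "m \<le> n" for m n
  proof
    fix E assume "E \<in> sets (natural_filtration m)"
    then obtain B where "E = {\<omega> \<in> space M. past m \<omega> \<in> B}" unfolding sets_natural_filtration by blast
    then have "E = {\<omega> \<in> space M. past n \<omega> \<in> {h. take (Suc m) h \<in> B}}"
      using that by (simp add: take_history)
    then show "E \<in> sets (natural_filtration n)" unfolding sets_natural_filtration by blast
  qed
qed

lemma measurable_natural_filtration:
  "(\<lambda>\<omega>. f (past n \<omega>)) \<in> borel_measurable (natural_filtration n)"
  for f :: "'s list \<Rightarrow> real"
proof -
  have "past n \<in> measurable (natural_filtration n) (count_space UNIV)"
    unfolding natural_filtration_def by (rule measurable_vimage_algebra1) simp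
  then show ?thesis by (rule measurable_compose) simp
qed

lemma density_distr_past:
  "density (distr M (count_space UNIV) (past n)) (\<lambda>h. ennreal (p h w))
   = distr (density M (indicator {\<omega> \<in> space M. X (Suc n) \<omega> = w})) (count_space UNIV) (past n)"
proof (rule measure_eqI_countable)
  fix h
  have past_eq: "past n -` {h} \<inter> space M = {\<omega> \<in> space M. past n \<omega> = h}" by auto
  have "emeasure (density (distr M (count_space UNIV) (past n)) (\<lambda>h. ennreal (p h w))) {h}
      = ennreal (prob {\<omega> \<in> space M. past n \<omega> = h} * p h w)"
    using p_bounds
    by (simp add: emeasure_density emeasure_distr past_eq emeasure_eq_measure
        ennreal_mult'[symmetric] mult.commute)
  also have "\<dots> = emeasure (distr (density M (indicator {\<omega> \<in> space M. X (Suc n) \<omega> = w}))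
      (count_space UNIV) (past n)) {h}"
    unfolding prob_past_Suc[symmetric] emeasure_eq_measure[symmetric]
    by (subst emeasure_distr_density_indicator) (auto intro!: arg_cong[of _ _ "emeasure M"])
  finally show "emeasure (density (distr M (count_space UNIV) (past n)) (\<lambda>h. ennreal (p h w))) {h}
      = emeasure (distr (density M (indicator {\<omega> \<in> space M. X (Suc n) \<omega> = w}))
        (count_space UNIV) (past n)) {h}" .
qed auto

lemma set_nn_integral_transition:
  "(\<integral>\<^sup>+ \<omega> \<in> {\<omega> \<in> space M. past n \<omega> \<in> B}. ennreal (p (past n \<omega>) w) \<partial>M)
   = emeasure M {\<omega> \<in> space M. past n \<omega> \<in> B \<and> X (Suc n) \<omega> = w}"
proof -
  let ?\<mu> = "distr M (count_space UNIV) (past n)"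
  have "(\<integral>\<^sup>+ \<omega> \<in> {\<omega> \<in> space M. past n \<omega> \<in> B}. ennreal (p (past n \<omega>) w) \<partial>M)
      = (\<integral>\<^sup>+ \<omega>. ennreal (p (past n \<omega>) w) * indicator B (past n \<omega>) \<partial>M)"
    by (intro nn_integral_cong) (auto simp: indicator_def)
  also have "\<dots> = (\<integral>\<^sup>+ h \<in> B. ennreal (p h w) \<partial>?\<mu>)"
    by (rule nn_integral_distr[symmetric]) auto
  also have "\<dots> = emeasure (density ?\<mu> (\<lambda>h. ennreal (p h w))) B"
    by (rule emeasure_density[symmetric]) auto
  also have "\<dots> = emeasure M {\<omega> \<in> space M. past n \<omega> \<in> B \<and> X (Suc n) \<omega> = w}"
    unfolding density_distr_past
    by (subst emeasure_distr_density_indicator) (auto intro!: arg_cong[of _ _ "emeasure M"])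
  finally show ?thesis .
qed

lemma real_cond_exp_step:
  "AE \<omega> in M. real_cond_exp M (natural_filtration n) (indicator {\<omega> \<in> space M. X (Suc n) \<omega> = w}) \<omega>
    = p (past n \<omega>) w"
proof (rule cond.real_cond_exp_charact)
  show "integrable M (indicator {\<omega> \<in> space M. X (Suc n) \<omega> = w} :: 'w \<Rightarrow> real)"
    by (simp add: emeasure_eq_measure)
  show "integrable M (\<lambda>\<omega>. p (past n \<omega>) w)"
    using p_bounds by (intro integrable_const_bound[where B = 1]) auto
  show "(\<lambda>\<omega>. p (past n \<omega>) w) \<in> borel_measurable (natural_filtration n)"
    by (rule measurable_natural_filtration)
  show "(LINT \<omega>:A|M. indicator {\<omega> \<in> space M. X (Suc n) \<omega> = w} \<omega>) = (LINT \<omega>:A|M. p (past n \<omega>) w)"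
    if A_sets: "A \<in> sets (natural_filtration n)" for A
  proof -
    obtain B where A: "A = {\<omega> \<in> space M. past n \<omega> \<in> B}"
      using A_sets by (auto simp: sets_natural_filtration)
    have [measurable]: "A \<in> sets M" unfolding A by measurable
    have "(LINT \<omega>:A|M. p (past n \<omega>) w)
        = enn2real (\<integral>\<^sup>+ \<omega> \<in> A. ennreal (p (past n \<omega>) w) \<partial>M)"
      unfolding set_lebesgue_integral_def using p_bounds
      by (subst integral_eq_nn_integral)
        (auto intro!: arg_cong[of _ _ enn2real] nn_integral_cong simp: indicator_def)
    also have "\<dots> = prob {\<omega> \<in> space M. past n \<omega> \<in> B \<and> X (Suc n) \<omega> = w}"
      unfolding A set_nn_integral_transition by (simp add: emeasure_eq_measure)
    also have "\<dots> = prob (A \<inter> {\<omega> \<in> space M. X (Suc n) \<omega> = w})"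
      unfolding A by (intro arg_cong[of _ _ prob]) auto
    also have "\<dots> = (LINT \<omega>:A|M. indicator {\<omega> \<in> space M. X (Suc n) \<omega> = w} \<omega>)"
      unfolding set_lebesgue_integral_def by (simp add: indicator_inter_arith[symmetric])
    finally show ?thesis by simp
  qed
qed

lemma cond_prob_step:
  assumes U: "finite U"
  shows "AE \<omega> in M. cond_prob k {\<omega> \<in> space M. X (Suc k) \<omega> \<in> U} \<omega> = (\<Sum>w\<in>U. p (past k \<omega>) w)"
proof -
  let ?step = "\<lambda>w. indicator {\<omega> \<in> space M. X (Suc k) \<omega> = w} :: 'w \<Rightarrow> real"
  have indicator_eq: "indicator {\<omega> \<in> space M. X (Suc k) \<omega> \<in> U} = (\<lambda>\<omega>. \<Sum>w\<in>U. ?step w \<omega>)"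
    using U by (auto simp: indicator_def fun_eq_iff)
  have cond_sum: "AE \<omega> in M. real_cond_exp M (natural_filtration k) (\<lambda>\<omega>. \<Sum>w\<in>U. ?step w \<omega>) \<omega>
      = (\<Sum>w\<in>U. real_cond_exp M (natural_filtration k) (?step w) \<omega>)"
    by (intro cond.real_cond_exp_sum) (simp add: emeasure_eq_measure)
  have cond_step: "AE \<omega> in M. \<forall>w\<in>U. real_cond_exp M (natural_filtration k) (?step w) \<omega>
      = p (past k \<omega>) w"
    using U real_cond_exp_step by (intro AE_finite_allI)
  from cond_sum cond_step show ?thesis
    unfolding cond_prob_def indicator_eq by eventually_elim simp
qed

theorem AE_summable_compensated_steps:
  fixes U :: "'s set" and g :: "nat \<Rightarrow> 's list \<Rightarrow> real"
  assumes U: "finite U"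
    and bounded: "AE \<omega> in M. \<forall>n. (\<Sum>k<n. (g k (past k \<omega>))\<^sup>2 * of_bool (X (Suc k) \<omega> \<in> U)) \<le> C"
  shows "AE \<omega> in M. summable (\<lambda>k. g k (past k \<omega>)
    * (of_bool (X (Suc k) \<omega> \<in> U) - (\<Sum>w\<in>U. p (past k \<omega>) w)))"
proof -
  define A where "A k = {\<omega> \<in> space M. X (Suc k) \<omega> \<in> U}" for k
  have A_sets: "A k \<in> sets (natural_filtration (Suc k))" for k
  proof -
    have "A k = {\<omega> \<in> space M. past (Suc k) \<omega> \<in> {h. last h \<in> U}}" by (simp add: A_def)
    then show ?thesis unfolding sets_natural_filtration by blast
  qed
  have A_indicator: "indicator (A k) \<omega>
      = (of_bool (X (Suc k) \<omega> \<in> U) :: real)" if "\<omega> \<in> space M" for k \<omega>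
    using that by (simp add: A_def indicator_def)
  have summable: "AE \<omega> in M. summable (\<lambda>k. compensated k (A k) (\<lambda>\<omega>. g k (past k \<omega>)) \<omega>)"
  proof (rule AE_summable_compensated[OF A_sets measurable_natural_filtration])
    show "AE \<omega> in M. \<forall>n. (\<Sum>k<n. (g k (past k \<omega>))\<^sup>2 * indicator (A k) \<omega>) \<le> C"
      using bounded AE_space by eventually_elim (simp add: A_indicator)
  qed
  have "AE \<omega> in M. \<forall>k. cond_prob k (A k) \<omega> = (\<Sum>w\<in>U. p (past k \<omega>) w)"
    unfolding AE_all_countable A_def using cond_prob_step[OF U] by blast
  with summable show ?thesis
    using AE_space by eventually_elim (simp add: compensated_def A_indicator)
qed

end

section \<open>The weights along a path\<close>

definition leaves :: "(nat \<Rightarrow> nat) \<Rightarrow> nat \<Rightarrow> vtx set" where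
  "leaves r i = Leaf i ` {1..r i}"

lemma finite_leaves [simp]: "finite (leaves r i)"
  by (simp add: leaves_def)

lemma Inner_notin_leaves [simp]: "Inner i \<notin> leaves r j"
  by (auto simp: leaves_def)

lemma Leaf_in_leaves_iff [simp]: "Leaf i m \<in> leaves r j \<longleftrightarrow> i = j \<and> m \<in> {1..r j}"
  by (auto simp: leaves_def)

lemma Inner_in_verts_iff [simp]: "Inner i \<in> verts d r \<longleftrightarrow> i \<in> {1..d}"
  and Leaf_in_verts_iff [simp]: "Leaf i m \<in> verts d r \<longleftrightarrow> i \<in> {1..d} \<and> m \<in> {1..r i}"
  by (auto simp: verts_def)

lemma verts_eq_UN: "verts d r = (\<Union>i\<in>{1..d}. insert (Inner i) (leaves r i))"
  by (auto simp: verts_def leaves_def)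

lemma finite_verts [simp]: "finite (verts d r)"
  by (simp add: verts_eq_UN)

lemma sum_verts: "sum f (verts d r) = (\<Sum>i\<in>{1..d}. f (Inner i) + sum f (leaves r i))"
  for f :: "vtx \<Rightarrow> 'b::comm_monoid_add"
proof -
  have "sum f (verts d r) = (\<Sum>i\<in>{1..d}. sum f (insert (Inner i) (leaves r i)))"
    unfolding verts_eq_UN by (intro sum.UNION_disjoint) (auto simp: leaves_def)
  then show ?thesis by simp
qed

lemma neighbours_Inner:
  "i \<in> {1..d} \<Longrightarrow> {v \<in> verts d r. adj (Inner i) v} = leaves r i \<union> Inner ` ({1..d} - {i})"
  by (auto simp: verts_eq_UN leaves_def)

lemma neighbours_Leaf: "i \<in> {1..d} \<Longrightarrow> {v \<in> verts d r. adj (Leaf i m) v} = {Inner i}"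
  by (auto simp: verts_eq_UN leaves_def)

lemma sum_of_bool_point: "finite S \<Longrightarrow> (\<Sum>v\<in>S. of_bool (a = v)) = (of_bool (a \<in> S) :: real)"
  by (simp add: of_bool_def)

locale vrrw_path =
  fixes d :: nat and r :: "nat \<Rightarrow> nat" and z0 :: "vtx \<Rightarrow> nat" and x :: "nat \<Rightarrow> vtx"
  assumes d_ge_2: "2 \<le> d" and z0_pos: "v \<in> verts d r \<Longrightarrow> 0 < z0 v"
    and x_in_verts: "x n \<in> verts d r" and x_adj: "adj (x n) (x (Suc n))"
begin

definition weight :: "nat \<Rightarrow> vtx \<Rightarrow> real" where
  "weight n v = real (Zhist z0 (history x n) v)"

definition Z :: "nat \<Rightarrow> nat \<Rightarrow> real" where "Z n i = weight n (Inner i)"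

definition L :: "nat \<Rightarrow> nat \<Rightarrow> real" where "L n i = sum (weight n) (leaves r i)"

definition N :: "nat \<Rightarrow> nat \<Rightarrow> real" where "N n i = sum (weight n) {v \<in> verts d r. adj (Inner i) v}"

definition T :: "nat \<Rightarrow> real" where "T n = real (tzero d r z0 + n)"

definition inner_visit :: "nat \<Rightarrow> nat \<Rightarrow> real" where "inner_visit n i = of_bool (x n = Inner i)"

definition leaf_visit :: "nat \<Rightarrow> nat \<Rightarrow> real" where "leaf_visit n i = of_bool (x n \<in> leaves r i)"

lemma visit_bounds [simp]:
  "0 \<le> inner_visit n i" "inner_visit n i \<le> 1" "0 \<le> leaf_visit n i" "leaf_visit n i \<le> 1"
  by (simp_all add: inner_visit_def leaf_visit_def)

lemma x_cases:
  obtains (inner) j where "j \<in> {1..d}" "x n = Inner j"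
    | (leaf) j m where "j \<in> {1..d}" "m \<in> {1..r j}" "x n = Leaf j m"
  using x_in_verts[of n] by (cases "x n") auto

lemma weight_0: "weight 0 v = real (z0 v)"
  by (simp add: weight_def Zhist_def history_def)

lemma weight_Suc: "weight (Suc n) v = weight n v + of_bool (x (Suc n) = v)"
  by (simp add: weight_def Zhist_def history_Suc)

lemma weight_nonneg [simp]: "0 \<le> weight n v"
  by (simp add: weight_def)

lemma Z_Suc: "Z (Suc n) i = Z n i + inner_visit (Suc n) i"
  by (simp add: Z_def inner_visit_def weight_Suc)

lemma L_Suc: "L (Suc n) i = L n i + leaf_visit (Suc n) i"
  by (simp add: L_def leaf_visit_def weight_Suc sum.distrib sum_of_bool_point)

lemma T_eq: "T n = (\<Sum>i\<in>{1..d}. Z n i + L n i)"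
proof -
  have "T n = sum (weight n) (verts d r)"
    by (induction n)
      (use x_in_verts in \<open>auto simp: T_def tzero_def weight_0 weight_Suc sum.distrib
        sum_of_bool_point\<close>)
  then show ?thesis by (simp add: sum_verts Z_def L_def)
qed

lemma sum_visits: "(\<Sum>i\<in>{1..d}. inner_visit n i + leaf_visit n i) = 1"
proof -
  have "(\<Sum>i\<in>{1..d}. inner_visit n i + leaf_visit n i) = (\<Sum>v\<in>verts d r. of_bool (x n = v))"
    by (simp add: sum_verts sum_of_bool_point inner_visit_def leaf_visit_def del: sum_of_bool_eq)
  then show ?thesis using x_in_verts by (simp add: sum_of_bool_point)
qed

lemma Z_ge_1: "i \<in> {1..d} \<Longrightarrow> 1 \<le> Z n i"
  using z0_pos[of "Inner i"]
  by (induction n) (auto simp: Z_Suc add_increasing2, auto simp: Z_def weight_0)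

lemma L_nonneg: "0 \<le> L n i"
  by (simp add: L_def sum_nonneg)

lemma L_0_ge_1_or_L_eq_0:
  assumes "i \<in> {1..d}"
  shows "1 \<le> L 0 i \<or> (\<forall>n. L n i = 0)"
proof (cases "r i")
  case 0
  then show ?thesis by (simp add: L_def leaves_def)
next
  case (Suc m)
  then have "0 < z0 (Leaf i 1)" using assms by (intro z0_pos) simp
  then have "1 \<le> weight 0 (Leaf i 1)" by (simp add: weight_0)
  also have "\<dots> \<le> L 0 i" unfolding L_def using Suc by (intro member_le_sum) auto
  finally show ?thesis ..
qed

lemma Z_add_L_le_T: "i \<in> {1..d} \<Longrightarrow> Z n i + L n i \<le> T n"
  unfolding T_eq by (intro member_le_sum[where f = "\<lambda>i. Z n i + L n i"]) (auto simp: Z_def L_nonneg)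

sublocale clock T
proof
  show "T (Suc n) = T n + 1" for n by (simp add: T_def)
  show "1 \<le> T 0"
    using Z_add_L_le_T[of 1 0] Z_ge_1[of 1 0] L_nonneg[of 0 1] d_ge_2 by simp
qed

lemma N_eq: "i \<in> {1..d} \<Longrightarrow> N n i = L n i + (\<Sum>j\<in>{1..d} - {i}. Z n j)"
  unfolding N_def neighbours_Inner L_def Z_def
  by (subst sum.union_disjoint) (auto simp: leaves_def sum.reindex inj_on_def)

lemma L_add_Z_le_N:
  assumes "i \<in> {1..d}" "j \<in> {1..d}" "i \<noteq> j"
  shows "L n i + Z n j \<le> N n i"
proof -
  have "Z n j \<le> (\<Sum>j\<in>{1..d} - {i}. Z n j)"
    using assms by (intro member_le_sum) (auto simp: Z_def)
  then show ?thesis using assms by (simp add: N_eq)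
qed

lemma ex_other_index: "\<exists>j\<in>{1..d}. i \<noteq> j"
  using d_ge_2 by (intro bexI[of _ "if i = 1 then 2 else 1"]) auto

lemma N_ge_1:
  assumes "i \<in> {1..d}"
  shows "1 \<le> N n i"
proof -
  obtain j where "j \<in> {1..d}" "i \<noteq> j" using ex_other_index by blast
  then show ?thesis
    using L_add_Z_le_N[of i j n] assms Z_ge_1[of j n] L_nonneg[of n i] by linarith
qed

lemma N_add_Z_le_T:
  assumes "i \<in> {1..d}"
  shows "N n i + Z n i \<le> T n"
proof -
  have "N n i + Z n i = L n i + (\<Sum>j\<in>{1..d}. Z n j)"
    using assms by (simp add: N_eq sum.remove[of _ i "Z n"])
  also have "L n i \<le> (\<Sum>j\<in>{1..d}. L n j)"
    using assms L_nonneg by (intro member_le_sum) auto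
  finally show ?thesis by (simp add: T_eq sum.distrib)
qed

lemma unit_growth_Z: "i \<in> {1..d} \<Longrightarrow> unit_growth (\<lambda>n. Z n i) (\<lambda>n. inner_visit (Suc n) i)"
  using Z_ge_1 by unfold_locales (auto simp: Z_Suc)

lemma unit_growth_L: "1 \<le> L 0 i \<Longrightarrow> unit_growth (\<lambda>n. L n i) (\<lambda>n. leaf_visit (Suc n) i)"
  by unfold_locales (auto simp: L_Suc)

lemma proportion_Z:
  assumes "i \<in> {1..d}"
  shows "proportion T (\<lambda>n. Z n i) (\<lambda>n. inner_visit (Suc n) i)"
  using Z_add_L_le_T[OF assms, of 0] Z_ge_1[OF assms, of 0] L_nonneg[of 0 i]
  by unfold_locales (auto simp: Z_Suc)

lemma proportion_L:
  assumes "i \<in> {1..d}"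
  shows "proportion T (\<lambda>n. L n i) (\<lambda>n. leaf_visit (Suc n) i)"
  using Z_add_L_le_T[OF assms, of 0] Z_ge_1[OF assms, of 0] L_nonneg[of 0 i]
  by unfold_locales (auto simp: L_Suc)

lemma leaf_visit_le_next_inner_visit: "leaf_visit n i \<le> inner_visit (Suc n) i"
  using x_adj[of n] by (cases "x n"; cases "x (Suc n)") (auto simp: leaf_visit_def inner_visit_def)

lemma next_leaf_visit_le_inner_visit: "leaf_visit (Suc n) i \<le> inner_visit n i"
  using x_adj[of n] by (cases "x n"; cases "x (Suc n)") (auto simp: leaf_visit_def inner_visit_def)

lemma inner_visit_le_next_visits:
  "inner_visit n i \<le> leaf_visit (Suc n) i + (\<Sum>m\<in>{1..d} - {i}. inner_visit (Suc n) m)"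
proof (cases "x n = Inner i")
  case True
  show ?thesis
  proof (cases rule: x_cases[of "Suc n"])
    case (inner j)
    then have "inner_visit (Suc n) j \<le> (\<Sum>m\<in>{1..d} - {i}. inner_visit (Suc n) m)"
      using x_adj[of n] True by (intro member_le_sum) auto
    then show ?thesis using inner True by (simp add: inner_visit_def leaf_visit_def)
  next
    case (leaf j m)
    then have "leaf_visit (Suc n) i = 1" using x_adj[of n] True by (simp add: leaf_visit_def)
    then show ?thesis using visit_bounds(2)[of n i] by (simp add: add_increasing2 sum_nonneg)
  qed
qed (simp add: inner_visit_def leaf_visit_def sum_nonneg)

subsection \<open>Transition probabilities and innovations\<close>

lemma vrrw_trans_eq:
  "vrrw_trans d r z0 (history x n) v =
    (if v \<in> verts d r \<and> adj (x n) v
     then weight n v / sum (weight n) {u \<in> verts d r. adj (x n) u} else 0)"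
  by (simp add: vrrw_trans_def weight_def)

lemma vrrw_trans_Inner:
  assumes i: "i \<in> {1..d}"
  shows "vrrw_trans d r z0 (history x n) (Inner i)
    = Z n i * ((\<Sum>m\<in>{1..d} - {i}. inner_visit n m / N n m) + leaf_visit n i / Z n i)"
proof (cases rule: x_cases[of n])
  case (inner j)
  have "(\<Sum>m\<in>{1..d} - {i}. inner_visit n m / N n m)
      = (\<Sum>m\<in>{1..d} - {i}. if m = j then 1 / N n j else 0)"
    using inner by (intro sum.cong) (auto simp: inner_visit_def)
  also have "\<dots> = (if i = j then 0 else 1 / N n j)" using inner by simp
  finally show ?thesis
    using inner i by (auto simp: vrrw_trans_eq leaf_visit_def Z_def N_def)
next
  case (leaf j m)
  then show ?thesis
    using i by (auto simp: vrrw_trans_eq leaf_visit_def inner_visit_def neighbours_Leaf Z_def)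
qed

lemma vrrw_trans_leaves:
  assumes i: "i \<in> {1..d}"
  shows "(\<Sum>v\<in>leaves r i. vrrw_trans d r z0 (history x n) v) = inner_visit n i * (L n i / N n i)"
proof -
  have "vrrw_trans d r z0 (history x n) v
      = inner_visit n i * (weight n v / N n i)" if "v \<in> leaves r i" for v
    using that i by (cases "x n") (auto simp: vrrw_trans_eq inner_visit_def N_def leaves_def)
  then show ?thesis by (simp add: L_def sum_divide_distrib sum_distrib_left)
qed

definition innovation :: "vtx set \<Rightarrow> nat \<Rightarrow> real" where
  "innovation U n = of_bool (x (Suc n) \<in> U) - (\<Sum>v\<in>U. vrrw_trans d r z0 (history x n) v)"

lemma innovation_Inner_over_Z:
  assumes "i \<in> {1..d}"
  shows "innovation {Inner i} n / Z n i
    = inner_visit (Suc n) i / Z n i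
      - ((\<Sum>m\<in>{1..d} - {i}. inner_visit n m / N n m) + leaf_visit n i / Z n i)"
  using Z_ge_1[OF assms, of n] assms
  by (simp add: innovation_def vrrw_trans_Inner inner_visit_def diff_divide_distrib)

lemma innovation_leaves:
  "i \<in> {1..d} \<Longrightarrow>
    innovation (leaves r i) n = leaf_visit (Suc n) i - inner_visit n i * (L n i / N n i)"
  by (simp add: innovation_def vrrw_trans_leaves leaf_visit_def)

definition leaf_density :: "nat \<Rightarrow> nat \<Rightarrow> real" where
  "leaf_density n i = L n i / (T n * T (Suc n))"

lemma leaf_density_nonneg [simp]: "0 \<le> leaf_density n i"
  by (simp add: leaf_density_def L_nonneg)

lemma leaf_density_le:
  assumes "i \<in> {1..d}"
  shows "leaf_density n i \<le> 1 / T (Suc n)"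
proof -
  have "L n i \<le> T n" using Z_add_L_le_T[OF assms, of n] Z_ge_1[OF assms, of n] by linarith
  then have "L n i / T n / T (Suc n) \<le> 1 / T (Suc n)" by (intro divide_right_mono) auto
  then show ?thesis by (simp add: leaf_density_def)
qed

lemma leaf_density_le_next: "leaf_density n i \<le> 3 * leaf_density (Suc n) i"
proof -
  have "leaf_density n i = 3 * (L n i / (T (Suc n) * (3 * T n)))"
    by (simp add: leaf_density_def mult.commute)
  also have "\<dots> \<le> 3 * (L (Suc n) i / (T (Suc n) * T (Suc (Suc n))))"
    using T_ge_1[of n] L_nonneg[of n i]
    by (intro mult_left_mono frac_le mult_pos_pos) (auto simp: T_Suc L_Suc)
  finally show ?thesis by (simp add: leaf_density_def)
qed

lemma N_mult_leaf_density_le: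
  assumes j: "j \<in> {1..d}" and m: "m \<in> {1..d}" and c: "0 \<le> c" and L_le: "L n i \<le> c * Z n j"
  shows "N n m * leaf_density n i \<le> c"
proof -
  have "N n m * L n i \<le> N n m * (c * Z n j)"
    using L_le N_ge_1[OF m, of n] by (intro mult_left_mono) auto
  also have "\<dots> = c * (N n m * Z n j)" by simp
  also have "\<dots> \<le> c * (T n * T (Suc n))"
    using c Z_ge_1[OF m, of n] Z_ge_1[OF j, of n] N_add_Z_le_T[OF m, of n]
      Z_add_L_le_T[OF j, of n] L_nonneg[of n j]
    by (intro mult_left_mono mult_mono) (auto simp: T_Suc)
  finally show ?thesis by (simp add: leaf_density_def divide_le_eq)
qed

lemma sum_squares_over_Z_le:
  assumes "i \<in> {1..d}"
  shows "(\<Sum>k<n. (1 / Z k i)\<^sup>2 * of_bool (x (Suc k) \<in> {Inner i})) \<le> 2"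
  using unit_growth.sum_over_Y_squared_le[OF unit_growth_Z[OF assms], of n]
  by (simp add: inner_visit_def power_divide)

lemma sum_squares_over_L_le:
  assumes "i \<in> {1..d}"
  shows "(\<Sum>k<n. (1 / L k i)\<^sup>2 * of_bool (x (Suc k) \<in> leaves r i)) \<le> 2"
  using L_0_ge_1_or_L_eq_0[OF assms]
proof
  assume "1 \<le> L 0 i"
  from unit_growth.sum_over_Y_squared_le[OF unit_growth_L[OF this], of n] show ?thesis
    by (simp add: leaf_visit_def power_divide)
qed simp

lemma sum_squares_leaf_density_le:
  assumes "i \<in> {1..d}"
  shows "(\<Sum>k<n. (leaf_density k i)\<^sup>2 * of_bool (x (Suc k) \<in> leaves r i)) \<le> 2"
proof -
  have "(leaf_density k i)\<^sup>2 * of_bool (x (Suc k) \<in> leaves r i) \<le> (1 / T (Suc k))\<^sup>2" for k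
    using power_mono[OF leaf_density_le[OF assms, of k], of 2] by simp
  then have "(\<Sum>k<n. (leaf_density k i)\<^sup>2 * of_bool (x (Suc k) \<in> leaves r i))
      \<le> (\<Sum>k<n. (1 / T (Suc k))\<^sup>2)"
    by (intro sum_mono)
  also have "\<dots> \<le> 2" by (rule sum_inverse_T_squared_le)
  finally show ?thesis .
qed

end

section \<open>Asymptotics along a typical path\<close>

text \<open>If \<open>i\<close> has no leaves, then \<open>L k i = 0\<close> and the quotients in the second series are 0.\<close>

locale typical_vrrw_path = vrrw_path +
  assumes d_ge_3: "3 \<le> d"
    and summable_innovation_Inner: "i \<in> {1..d} \<Longrightarrow> summable (\<lambda>k. innovation {Inner i} k / Z k i)"
    and summable_innovation_leaves: "i \<in> {1..d} \<Longrightarrow> summable (\<lambda>k. innovation (leaves r i) k / L k i)"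
    and summable_leaf_density_innovation:
      "i \<in> {1..d} \<Longrightarrow> summable (\<lambda>k. leaf_density k i * innovation (leaves r i) k)"
begin

subsection \<open>The leaves are negligible\<close>

definition log_drift :: "nat set \<Rightarrow> nat \<Rightarrow> real" where
  "log_drift S k = (\<Sum>m\<in>S. inner_visit k m / N k m)"

lemma visit_over_N_nonneg: "m \<in> {1..d} \<Longrightarrow> 0 \<le> inner_visit k m / N k m"
  using N_ge_1[of m k] by simp

lemma log_drift_nonneg: "S \<subseteq> {1..d} \<Longrightarrow> 0 \<le> log_drift S k"
  unfolding log_drift_def by (intro sum_nonneg visit_over_N_nonneg) auto

lemma log_drift_le_1:
  assumes S: "S \<subseteq> {1..d}"
  shows "log_drift S k \<le> 1"
proof -
  have "log_drift S k \<le> (\<Sum>m\<in>S. inner_visit k m + leaf_visit k m)"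
    unfolding log_drift_def
  proof (rule sum_mono)
    fix m assume "m \<in> S"
    then have "inner_visit k m / N k m \<le> inner_visit k m / 1"
      using N_ge_1[of m k] S by (intro divide_left_mono) auto
    then show "inner_visit k m / N k m \<le> inner_visit k m + leaf_visit k m"
      by (simp add: add_increasing2)
  qed
  also have "\<dots> \<le> (\<Sum>m\<in>{1..d}. inner_visit k m + leaf_visit k m)"
    using S by (intro sum_mono2) auto
  finally show ?thesis by (simp only: sum_visits)
qed

lemma sum_log_drift_le_ln_Z:
  assumes i: "i \<in> {1..d}"
  obtains C where "\<And>n. (\<Sum>k<n. log_drift ({1..d} - {i}) k) \<le> ln (Z n i) + C"
proof -
  obtain C where C: "\<And>n. \<bar>\<Sum>k<n. innovation {Inner i} k / Z k i\<bar> \<le> C"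
    using summable_imp_bounded_partial_sums[OF summable_innovation_Inner[OF i]] by blast
  have "(\<Sum>k<n. log_drift ({1..d} - {i}) k) \<le> ln (Z n i) + (C + 2)" for n
  proof -
    have "log_drift ({1..d} - {i}) k
        \<le> inner_visit (Suc k) i / Z k i - innovation {Inner i} k / Z k i" for k
      using Z_ge_1[OF i, of k] by (simp add: innovation_Inner_over_Z[OF i] log_drift_def)
    then have "(\<Sum>k<n. log_drift ({1..d} - {i}) k)
        \<le> (\<Sum>k<n. inner_visit (Suc k) i / Z k i) - (\<Sum>k<n. innovation {Inner i} k / Z k i)"
      unfolding sum_subtractf[symmetric] by (intro sum_mono)
    then show ?thesis
      using unit_growth.sum_over_Y_le[OF unit_growth_Z[OF i], of n] C[of n] by linarith
  qed
  then show ?thesis by (rule that)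
qed

lemma ln_L_le:
  assumes i: "i \<in> {1..d}" and L_0: "1 \<le> L 0 i"
  obtains C where "\<And>n. ln (L n i) \<le> (\<Sum>k<n. inner_visit k i / N k i) + C"
proof -
  obtain C where C: "\<And>n. \<bar>\<Sum>k<n. innovation (leaves r i) k / L k i\<bar> \<le> C"
    using summable_imp_bounded_partial_sums[OF summable_innovation_leaves[OF i]] by blast
  have "ln (L n i) \<le> (\<Sum>k<n. inner_visit k i / N k i) + (ln (L 0 i) + C)" for n
  proof -
    have "leaf_visit (Suc k) i / L k i
        = inner_visit k i / N k i + innovation (leaves r i) k / L k i" for k
      using unit_growth.Y_ge_1[OF unit_growth_L[OF L_0], of k]
      by (simp add: innovation_leaves[OF i] diff_divide_distrib)
    then have "ln (L n i)
        \<le> ln (L 0 i) + ((\<Sum>k<n. inner_visit k i / N k i)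
          + (\<Sum>k<n. innovation (leaves r i) k / L k i))"
      using unit_growth.ln_Y_le[OF unit_growth_L[OF L_0], of n] by (simp add: sum.distrib)
    then show ?thesis using C[of n] by linarith
  qed
  then show ?thesis by (rule that)
qed

text \<open>Visits to \<open>i\<close> raise \<open>ln L\<^sub>i\<close> and \<open>ln Z\<^sub>j\<close> at the same rate, so only the visits to the
  remaining interior vertices separate them.\<close>

lemma L_le_Z_mult_exp_drift:
  assumes i: "i \<in> {1..d}" and j: "j \<in> {1..d}" and "i \<noteq> j"
  obtains C where "0 < C" "\<And>n. L n i \<le> C * Z n j * exp (- (\<Sum>k<n. log_drift ({1..d} - {i, j}) k))"
proof (cases "1 \<le> L 0 i")
  case False
  then have "L n i = 0" for n using L_0_ge_1_or_L_eq_0[OF i] by blast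
  then show ?thesis by (intro that[of 1]) (auto simp: Z_def)
next
  case True
  obtain C\<^sub>L where C\<^sub>L: "\<And>n. ln (L n i) \<le> (\<Sum>k<n. inner_visit k i / N k i) + C\<^sub>L"
    using ln_L_le[OF i True] by blast
  obtain C\<^sub>Z where C\<^sub>Z: "\<And>n. (\<Sum>k<n. log_drift ({1..d} - {j}) k) \<le> ln (Z n j) + C\<^sub>Z"
    using sum_log_drift_le_ln_Z[OF j] by blast
  have drift_split: "log_drift ({1..d} - {j}) k
      = inner_visit k i / N k i + log_drift ({1..d} - {i, j}) k" for k
    unfolding log_drift_def Diff_insert[of _ i "{j}"]
    using i \<open>i \<noteq> j\<close> by (intro sum.remove) auto
  have "L n i \<le> exp (C\<^sub>L + C\<^sub>Z) * Z n j * exp (- (\<Sum>k<n. log_drift ({1..d} - {i, j}) k))" for n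
  proof -
    have positive: "0 < L n i" "0 < Z n j"
      using unit_growth.Y_ge_1[OF unit_growth_L[OF True], of n] Z_ge_1[OF j, of n] by linarith+
    have "ln (L n i) \<le> (C\<^sub>L + C\<^sub>Z) + ln (Z n j) + - (\<Sum>k<n. log_drift ({1..d} - {i, j}) k)"
      using C\<^sub>L[of n] C\<^sub>Z[of n] unfolding drift_split sum.distrib by linarith
    then have "exp (ln (L n i))
        \<le> exp ((C\<^sub>L + C\<^sub>Z) + ln (Z n j) + - (\<Sum>k<n. log_drift ({1..d} - {i, j}) k))"
      by (simp only: exp_le_cancel_iff)
    then show ?thesis using positive by (simp only: exp_add exp_ln)
  qed
  then show ?thesis using that[of "exp (C\<^sub>L + C\<^sub>Z)"] by simp
qed

lemma L_le_mult_N: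
  assumes i: "i \<in> {1..d}"
  obtains q where "q < 1" "\<And>n. L n i \<le> q * N n i"
proof -
  obtain j where j: "j \<in> {1..d}" "i \<noteq> j" using ex_other_index by blast
  obtain C where C: "0 < C" "\<And>n. L n i \<le> C * Z n j * exp (- (\<Sum>k<n. log_drift ({1..d} - {i, j}) k))"
    using L_le_Z_mult_exp_drift[OF i j] by blast
  have "L n i \<le> C / (1 + C) * N n i" for n
  proof -
    have "exp (- (\<Sum>k<n. log_drift ({1..d} - {i, j}) k)) \<le> 1"
      by (simp add: sum_nonneg log_drift_nonneg)
    then have "C * Z n j * exp (- (\<Sum>k<n. log_drift ({1..d} - {i, j}) k)) \<le> C * Z n j * 1"
      using C(1) Z_ge_1[OF j(1), of n] by (intro mult_left_mono) auto
    then have "L n i \<le> C * Z n j" using C(2)[of n] by linarith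
    moreover have "C * (L n i + Z n j) \<le> C * N n i"
      using L_add_Z_le_N[OF i j] C(1) by (intro mult_left_mono) auto
    ultimately show ?thesis using C(1) by (simp add: field_simps)
  qed
  then show ?thesis using C(1) by (intro that[of "C / (1 + C)"]) auto
qed

lemma summable_other_visits_leaf_density:
  assumes i: "i \<in> {1..d}" and m: "m \<in> {1..d}" "m \<noteq> i"
  shows "summable (\<lambda>k. inner_visit k m * leaf_density k i)"
proof -
  have "\<not> {1..d} \<subseteq> {i, m}"
    using card_mono[of "{i, m}" "{1..d}"] d_ge_3 by (auto simp: card_insert_if split: if_splits)
  then obtain j where j: "j \<in> {1..d}" "j \<noteq> i" "j \<noteq> m" by blast
  define b where "b = log_drift ({1..d} - {i, j})"
  obtain C where C: "0 < C" "\<And>n. L n i \<le> C * Z n j * exp (- (\<Sum>k<n. b k))"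
    using L_le_Z_mult_exp_drift[OF i j(1)] j(2) unfolding b_def by metis
  have b_bounds: "0 \<le> b k" "b k \<le> 1" for k
    unfolding b_def by (auto intro!: log_drift_nonneg log_drift_le_1)
  have bound: "inner_visit k m * leaf_density k i \<le> C * (b k * exp (- (\<Sum>l<k. b l)))" for k
  proof -
    have density: "N k m * leaf_density k i \<le> C * exp (- (\<Sum>l<k. b l))"
      using C(2)[of k] C(1) by (intro N_mult_leaf_density_le[OF j(1) m(1)]) (auto simp: mult_ac)
    have "inner_visit k m * leaf_density k i = inner_visit k m / N k m * (N k m * leaf_density k i)"
      using N_ge_1[OF m(1), of k] by simp
    also have "\<dots> \<le> b k * (C * exp (- (\<Sum>l<k. b l)))"
    proof (rule mult_mono[OF _ density])
      show "inner_visit k m / N k m \<le> b k"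
        unfolding b_def log_drift_def using m j visit_over_N_nonneg
        by (intro member_le_sum[where f = "\<lambda>m. inner_visit k m / N k m"]) auto
      show "0 \<le> N k m * leaf_density k i" using N_ge_1[OF m(1), of k] by simp
    qed (rule b_bounds)
    finally show ?thesis by (simp add: mult_ac)
  qed
  have "summable (\<lambda>k. C * (b k * exp (- (\<Sum>l<k. b l))))"
    using b_bounds
    by (intro summable_mult summableI_nonneg_bounded[OF _ sum_mult_exp_neg_partial_sums_le]) auto
  then show ?thesis by (rule summable_comparison_test') (use bound in simp)
qed

lemma summable_next_visits_leaf_density:
  assumes "summable (\<lambda>k. inner_visit k m * leaf_density k i)"
  shows "summable (\<lambda>k. inner_visit (Suc k) m * leaf_density k i)"
proof (rule summable_comparison_test'[where N = 0])
  show "summable (\<lambda>k. 3 * (inner_visit (Suc k) m * leaf_density (Suc k) i))"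
    using assms by (intro summable_mult) (subst summable_Suc_iff)
  show "norm (inner_visit (Suc k) m * leaf_density k i)
      \<le> 3 * (inner_visit (Suc k) m * leaf_density (Suc k) i)" for k
    using mult_left_mono[OF leaf_density_le_next, of "inner_visit (Suc k) m" k i]
    by (simp add: mult_ac)
qed

text \<open>From \<open>i\<close> the walk moves to another interior vertex with probability at least \<open>1 - q\<close>, and
  those moves are already under control.\<close>

lemma summable_visits_leaf_density:
  assumes i: "i \<in> {1..d}"
  shows "summable (\<lambda>k. inner_visit k i * leaf_density k i)"
proof -
  obtain q where q: "q < 1" "\<And>n. L n i \<le> q * N n i" using L_le_mult_N[OF i] by blast
  define exits where "exits k = leaf_density k i * (inner_visit k i - leaf_visit (Suc k) i)" for k
  have "summable exits"
  proof (rule summable_comparison_test'[where N = 0])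
    show "summable (\<lambda>k. \<Sum>m\<in>{1..d} - {i}. inner_visit (Suc k) m * leaf_density k i)"
      using i
      by (intro summable_sum summable_next_visits_leaf_density
          summable_other_visits_leaf_density) auto
    fix k
    have "exits k \<le> leaf_density k i * (\<Sum>m\<in>{1..d} - {i}. inner_visit (Suc k) m)"
      unfolding exits_def using inner_visit_le_next_visits[of k i] by (intro mult_left_mono) auto
    then show "norm (exits k) \<le> (\<Sum>m\<in>{1..d} - {i}. inner_visit (Suc k) m * leaf_density k i)"
      using next_leaf_visit_le_inner_visit[of k i]
      by (simp add: exits_def sum_distrib_left mult.commute)
  qed
  then have "summable (\<lambda>k. exits k + leaf_density k i * innovation (leaves r i) k)"
    by (intro summable_add summable_leaf_density_innovation[OF i])
  then have "summable (\<lambda>k. 1 / (1 - q) * (exits k + leaf_density k i * innovation (leaves r i) k))"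
    by (rule summable_mult)
  then show ?thesis
  proof (rule summable_comparison_test'[where N = 0])
    fix k
    have "1 - q \<le> 1 - L k i / N k i"
      using q(2)[of k] N_ge_1[OF i, of k] by (simp add: divide_le_eq)
    then have "inner_visit k i * leaf_density k i * (1 - q)
        \<le> inner_visit k i * leaf_density k i * (1 - L k i / N k i)"
      by (intro mult_left_mono) auto
    also have "\<dots> = exits k + leaf_density k i * innovation (leaves r i) k"
      by (simp add: exits_def innovation_leaves[OF i] algebra_simps)
    finally show "norm (inner_visit k i * leaf_density k i)
        \<le> 1 / (1 - q) * (exits k + leaf_density k i * innovation (leaves r i) k)"
      using q(1) by (simp add: le_divide_eq)
  qed
qed

theorem summable_leaf_density:
  assumes i: "i \<in> {1..d}"
  shows "summable (\<lambda>k. leaf_density k i)"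
proof (rule summable_comparison_test'[where N = 0])
  have "summable (\<lambda>k. inner_visit k m * leaf_density k i)" if "m \<in> {1..d}" for m
    using summable_visits_leaf_density summable_other_visits_leaf_density i that
    by (cases "m = i") auto
  then show "summable (\<lambda>k. \<Sum>m\<in>{1..d}. inner_visit k m * leaf_density k i
      + inner_visit (Suc k) m * leaf_density k i)"
    using i by (intro summable_sum summable_add summable_next_visits_leaf_density) auto
  fix k
  have "leaf_density k i = (\<Sum>m\<in>{1..d}. (inner_visit k m + leaf_visit k m) * leaf_density k i)"
    unfolding sum_distrib_right[symmetric] by (simp only: sum_visits)
  also have "\<dots> \<le> (\<Sum>m\<in>{1..d}. (inner_visit k m + inner_visit (Suc k) m) * leaf_density k i)"
    by (intro sum_mono mult_right_mono add_left_mono leaf_visit_le_next_inner_visit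
        leaf_density_nonneg)
  finally show "norm (leaf_density k i)
      \<le> (\<Sum>m\<in>{1..d}. inner_visit k m * leaf_density k i + inner_visit (Suc k) m * leaf_density k i)"
    by (simp add: distrib_right)
qed

subsection \<open>The interior proportions equalize\<close>

lemma sum_log_drift_le:
  obtains C where "\<And>n. (real d - 1) * (\<Sum>k<n. log_drift {1..d} (Suc k))
      \<le> real d * (\<Sum>k<n. 1 / T (Suc k)) + C"
proof -
  have "\<exists>C. \<forall>n. (\<Sum>k<n. log_drift ({1..d} - {i}) k) \<le> ln (Z n i) + C" if "i \<in> {1..d}" for i
    using sum_log_drift_le_ln_Z[OF that] by metis
  then obtain c where c: "\<And>i n. i \<in> {1..d} \<Longrightarrow> (\<Sum>k<n. log_drift ({1..d} - {i}) k) \<le> ln (Z n i) + c i"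
    by metis
  have others: "(\<Sum>i\<in>{1..d}. log_drift ({1..d} - {i}) k) = (real d - 1) * log_drift {1..d} k" for k
    by (simp add: log_drift_def sum_diff1 sum_subtractf algebra_simps)
  have "(real d - 1) * (\<Sum>k<n. log_drift {1..d} (Suc k))
      \<le> real d * (\<Sum>k<n. 1 / T (Suc k)) + (real d * ln (T 1) + (\<Sum>i\<in>{1..d}. c i))" for n
  proof -
    have "(real d - 1) * (\<Sum>k<n. log_drift {1..d} (Suc k))
        \<le> (real d - 1) * (\<Sum>k<Suc n. log_drift {1..d} k)"
      unfolding sum.lessThan_Suc_shift using d_ge_2 log_drift_nonneg[of "{1..d}" 0]
      by (intro mult_left_mono) auto
    also have "\<dots> = (\<Sum>i\<in>{1..d}. \<Sum>k<Suc n. log_drift ({1..d} - {i}) k)"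
      unfolding sum_distrib_left others[symmetric] by (rule sum.swap)
    also have "\<dots> \<le> (\<Sum>i\<in>{1..d}. ln (T (Suc n)) + c i)"
    proof (rule sum_mono)
      fix i assume i: "i \<in> {1..d}"
      have "ln (Z (Suc n) i) \<le> ln (T (Suc n))"
        using Z_ge_1[OF i, of "Suc n"] Z_add_L_le_T[OF i, of "Suc n"] L_nonneg[of "Suc n" i] by simp
      then show "(\<Sum>k<Suc n. log_drift ({1..d} - {i}) k) \<le> ln (T (Suc n)) + c i"
        using c[OF i, of "Suc n"] by linarith
    qed
    also have "\<dots> = real d * ln (T (Suc n)) + (\<Sum>i\<in>{1..d}. c i)" by (simp add: sum.distrib)
    also note ln_T_Suc_le[of n]
    finally show ?thesis using d_ge_2 by (simp add: distrib_left)
  qed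
  then show ?thesis by (rule that)
qed

definition slope :: real where "slope = (real d)\<^sup>2 / (real d - 1)"

text \<open>The tangent of \<open>\<lambda>v. (d - 1) / (1 - v)\<close> at \<open>1 / d\<close>, evaluated at \<open>Z\<^sub>i / T\<close>.\<close>

definition tangent :: "nat \<Rightarrow> nat \<Rightarrow> real" where
  "tangent k i = real d + slope * (Z k i / T k - 1 / real d)"

definition square_deviation :: "nat \<Rightarrow> real" where
  "square_deviation k = (\<Sum>i\<in>{1..d}. (Z k i / T k - 1 / real d)\<^sup>2)"

lemma slope_pos: "0 < slope"
  using d_ge_2 by (simp add: slope_def)

lemma tangent_le_T_over_N:
  assumes i: "i \<in> {1..d}"
  shows "tangent k i \<le> (real d - 1) * (T k / N k i)"
proof -
  define s where "s = (real d - 1) / real d"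
  have s: "0 < s" using d_ge_2 by (simp add: s_def)
  have N: "0 < N k i / T k" using N_ge_1[OF i, of k] by (simp add: divide_pos_pos)
  have "tangent k i = (real d - 1) * (2 / s - (1 - Z k i / T k) / s\<^sup>2)"
    using d_ge_2 unfolding tangent_def slope_def s_def
    by (simp add: power2_eq_square divide_simps) (simp add: algebra_simps)
  also have "\<dots> \<le> (real d - 1) * (2 / s - N k i / T k / s\<^sup>2)"
  proof -
    have "N k i / T k \<le> 1 - Z k i / T k"
      using N_add_Z_le_T[OF i, of k] by (simp add: field_simps)
    then have "N k i / T k / s\<^sup>2 \<le> (1 - Z k i / T k) / s\<^sup>2" by (rule divide_right_mono) simp
    then show ?thesis using d_ge_2 by (intro mult_left_mono) auto
  qed
  also have "\<dots> \<le> (real d - 1) * (1 / (N k i / T k))"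
    using d_ge_2 by (intro mult_left_mono tangent_le_inverse[OF s N]) auto
  finally show ?thesis by simp
qed

lemma tangent_le_visit_over_N:
  assumes i: "i \<in> {1..d}"
  shows "tangent k i * (inner_visit (Suc k) i / T (Suc k))
      \<le> (real d - 1) * (inner_visit (Suc k) i / N (Suc k) i)"
proof (cases "inner_visit (Suc k) i = 0")
  case False
  then have visit: "inner_visit (Suc k) i = 1" by (simp add: inner_visit_def)
  have "Z k i / T k \<le> Z (Suc k) i / T (Suc k)"
    using proportion.ratio_le_ratio_Suc[OF proportion_Z[OF i], of k] visit
    by (simp add: proportion.ratio_def[OF proportion_Z[OF i]])
  then have "tangent k i \<le> tangent (Suc k) i"
    using slope_pos unfolding tangent_def by (intro add_left_mono mult_left_mono) auto
  also have "\<dots> \<le> (real d - 1) * (T (Suc k) / N (Suc k) i)" by (rule tangent_le_T_over_N[OF i])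
  finally have "tangent k i / T (Suc k) \<le> (real d - 1) * (T (Suc k) / N (Suc k) i) / T (Suc k)"
    by (rule divide_right_mono) simp
  then show ?thesis by (simp add: visit)
qed simp

lemma sum_tangent_proportion_le:
  assumes i: "i \<in> {1..d}"
  shows "(\<Sum>k<n. tangent k i * (Z k i / T k / T (Suc k)))
    \<le> (real d - 1) * (\<Sum>k<n. inner_visit (Suc k) i / N (Suc k) i)
      + 2 * (\<bar>real d - slope / real d\<bar> + slope)"
proof -
  interpret proportion T "\<lambda>k. Z k i" "\<lambda>k. inner_visit (Suc k) i" by (rule proportion_Z[OF i])
  have tangent_eq: "tangent k i = (real d - slope / real d) + slope * ratio k" for k
    by (simp add: tangent_def ratio_def algebra_simps)
  have "(\<Sum>k<n. tangent k i * (ratio k / T (Suc k)))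
      \<le> (\<Sum>k<n. tangent k i * (inner_visit (Suc k) i / T (Suc k)))
        + 2 * (\<bar>real d - slope / real d\<bar> + slope)"
    unfolding tangent_eq using slope_pos by (intro affine_occupation_le) simp
  also have "(\<Sum>k<n. tangent k i * (inner_visit (Suc k) i / T (Suc k)))
      \<le> (real d - 1) * (\<Sum>k<n. inner_visit (Suc k) i / N (Suc k) i)"
    unfolding sum_distrib_left by (intro sum_mono tangent_le_visit_over_N[OF i])
  finally show ?thesis by (simp add: ratio_def)
qed

lemma sum_tangent_mult_proportion:
  "(\<Sum>i\<in>{1..d}. tangent k i * (Z k i / T k))
   = real d + slope * square_deviation k - (real d + slope / real d) * (\<Sum>i\<in>{1..d}. L k i / T k)"
proof -
  define \<epsilon> where "\<epsilon> i = Z k i / T k - 1 / real d" for i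
  have "(\<Sum>i\<in>{1..d}. Z k i / T k) + (\<Sum>i\<in>{1..d}. L k i / T k) = 1"
    unfolding sum.distrib[symmetric] add_divide_distrib[symmetric] sum_divide_distrib[symmetric]
      T_eq[symmetric]
    by simp
  then have sum_\<epsilon>: "(\<Sum>i\<in>{1..d}. \<epsilon> i) = - (\<Sum>i\<in>{1..d}. L k i / T k)"
    using d_ge_2 by (simp add: \<epsilon>_def sum_subtractf)
  have "tangent k i * (Z k i / T k) = 1 + (real d + slope / real d) * \<epsilon> i + slope * (\<epsilon> i)\<^sup>2" for i
    using d_ge_2 by (simp add: tangent_def \<epsilon>_def power2_eq_square field_simps)
  then have "(\<Sum>i\<in>{1..d}. tangent k i * (Z k i / T k))
      = real d + (real d + slope / real d) * (\<Sum>i\<in>{1..d}. \<epsilon> i) + slope * (\<Sum>i\<in>{1..d}. (\<epsilon> i)\<^sup>2)"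
    by (simp add: sum.distrib sum_distrib_left)
  then show ?thesis unfolding sum_\<epsilon> by (simp add: square_deviation_def \<epsilon>_def)
qed

lemma sum_tangent_over_T_Suc:
  "(\<Sum>i\<in>{1..d}. tangent k i * (Z k i / T k / T (Suc k)))
   = real d * (1 / T (Suc k)) + slope * (square_deviation k / T (Suc k))
     - (real d + slope / real d) * (\<Sum>i\<in>{1..d}. leaf_density k i)"
proof -
  have density: "(\<Sum>i\<in>{1..d}. leaf_density k i) = (\<Sum>i\<in>{1..d}. L k i / T k) / T (Suc k)"
    by (simp add: leaf_density_def sum_divide_distrib)
  have "(\<Sum>i\<in>{1..d}. tangent k i * (Z k i / T k / T (Suc k)))
      = (\<Sum>i\<in>{1..d}. tangent k i * (Z k i / T k)) / T (Suc k)"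
    by (simp add: sum_divide_distrib)
  then show ?thesis
    unfolding sum_tangent_mult_proportion density
    by (simp add: add_divide_distrib diff_divide_distrib)
qed

lemma sum_square_deviation_le:
  obtains C where "\<And>n. slope * (\<Sum>k<n. square_deviation k / T (Suc k))
    \<le> (real d + slope / real d) * (\<Sum>k<n. \<Sum>i\<in>{1..d}. leaf_density k i) + C"
proof -
  obtain C where C: "\<And>n. (real d - 1) * (\<Sum>k<n. log_drift {1..d} (Suc k))
      \<le> real d * (\<Sum>k<n. 1 / T (Suc k)) + C"
    using sum_log_drift_le by blast
  define C' where "C' = (\<Sum>i\<in>{1..d}. 2 * (\<bar>real d - slope / real d\<bar> + slope))"
  have "slope * (\<Sum>k<n. square_deviation k / T (Suc k))
      \<le> (real d + slope / real d) * (\<Sum>k<n. \<Sum>i\<in>{1..d}. leaf_density k i) + (C + C')" for n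
  proof -
    have "(\<Sum>k<n. \<Sum>i\<in>{1..d}. tangent k i * (Z k i / T k / T (Suc k)))
        = (\<Sum>i\<in>{1..d}. \<Sum>k<n. tangent k i * (Z k i / T k / T (Suc k)))"
      by (rule sum.swap)
    also have "\<dots> \<le> (\<Sum>i\<in>{1..d}. (real d - 1) * (\<Sum>k<n. inner_visit (Suc k) i / N (Suc k) i)
        + 2 * (\<bar>real d - slope / real d\<bar> + slope))"
      by (intro sum_mono sum_tangent_proportion_le)
    also have "\<dots> = (real d - 1) * (\<Sum>k<n. log_drift {1..d} (Suc k)) + C'"
      unfolding sum.distrib log_drift_def sum_distrib_left[symmetric] C'_def
      by (subst sum.swap) simp
    finally show ?thesis
      using C[of n]
      unfolding sum_tangent_over_T_Suc sum.distrib sum_subtractf sum_distrib_left[symmetric]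
      by linarith
  qed
  then show ?thesis by (rule that)
qed

theorem summable_square_deviation: "summable (\<lambda>k. square_deviation k / T (Suc k))"
proof -
  define c where "c = real d + slope / real d"
  obtain C where C: "\<And>n. slope * (\<Sum>k<n. square_deviation k / T (Suc k))
      \<le> c * (\<Sum>k<n. \<Sum>i\<in>{1..d}. leaf_density k i) + C"
    using sum_square_deviation_le unfolding c_def by blast
  have density: "summable (\<lambda>k. \<Sum>i\<in>{1..d}. leaf_density k i)"
    by (intro summable_sum summable_leaf_density)
  show ?thesis
  proof (rule summableI_nonneg_bounded)
    fix n
    have "slope * (\<Sum>k<n. square_deviation k / T (Suc k))
        \<le> c * (\<Sum>k<n. \<Sum>i\<in>{1..d}. leaf_density k i) + C"
      by (rule C)
    also have "\<dots> \<le> c * (\<Sum>k. \<Sum>i\<in>{1..d}. leaf_density k i) + C"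
      using slope_pos density
      by (intro add_right_mono mult_left_mono sum_le_suminf) (auto simp: c_def sum_nonneg)
    finally show "(\<Sum>k<n. square_deviation k / T (Suc k))
        \<le> (c * (\<Sum>k. \<Sum>i\<in>{1..d}. leaf_density k i) + C) / slope"
      using slope_pos by (simp add: le_divide_eq mult.commute)
  qed (simp add: square_deviation_def sum_nonneg)
qed

subsection \<open>Limits of the proportions\<close>

theorem leaf_proportion_tendsto:
  assumes i: "i \<in> {1..d}"
  shows "(\<lambda>k. L k i / T k) \<longlonglongrightarrow> 0"
proof -
  interpret proportion T "\<lambda>k. L k i" "\<lambda>k. leaf_visit (Suc k) i" by (rule proportion_L[OF i])
  have "ratio \<longlonglongrightarrow> 0"
  proof (rule tendsto_if_summable_square_deviation)
    have "(ratio k - 0)\<^sup>2 / T (Suc k) \<le> leaf_density k i" for k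
    proof -
      have "(ratio k)\<^sup>2 \<le> ratio k"
        using ratio_bounds[of k] by (simp add: power2_eq_square mult_left_le)
      then have "(ratio k)\<^sup>2 / T (Suc k) \<le> ratio k / T (Suc k)" by (rule divide_right_mono) simp
      then show ?thesis by (simp add: ratio_def leaf_density_def)
    qed
    then show "summable (\<lambda>k. (ratio k - 0)\<^sup>2 / T (Suc k))"
      by (intro summable_comparison_test'[OF summable_leaf_density[OF i], where N = 0]) auto
  qed auto
  then show ?thesis by (simp add: ratio_def[abs_def])
qed

theorem inner_proportion_tendsto:
  assumes i: "i \<in> {1..d}"
  shows "(\<lambda>k. Z k i / T k) \<longlonglongrightarrow> 1 / real d"
proof -
  interpret proportion T "\<lambda>k. Z k i" "\<lambda>k. inner_visit (Suc k) i" by (rule proportion_Z[OF i])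
  have "ratio \<longlonglongrightarrow> 1 / real d"
  proof (rule tendsto_if_summable_square_deviation)
    have "(ratio k - 1 / real d)\<^sup>2 / T (Suc k) \<le> square_deviation k / T (Suc k)" for k
      unfolding square_deviation_def ratio_def using i
      by (intro divide_right_mono member_le_sum[where f = "\<lambda>i. (Z k i / T k - 1 / real d)\<^sup>2"]) auto
    then show "summable (\<lambda>k. (ratio k - 1 / real d)\<^sup>2 / T (Suc k))"
      by (intro summable_comparison_test'[OF summable_square_deviation, where N = 0]) auto
  qed (use d_ge_2 in auto)
  then show ?thesis by (simp add: ratio_def[abs_def])
qed

end

section \<open>Almost sure convergence\<close>

instance vtx :: countable
  by countable_datatype

lemma vrrw_trans_bounds: "0 \<le> vrrw_trans d r z0 h v" "vrrw_trans d r z0 h v \<le> 1"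
proof -
  have "real (Zhist z0 h v) \<le> (\<Sum>u\<in>{u \<in> verts d r. adj (last h) u}. real (Zhist z0 h u))"
    if "v \<in> verts d r" "adj (last h) v"
    using that by (intro member_le_sum) auto
  then show "0 \<le> vrrw_trans d r z0 h v" "vrrw_trans d r z0 h v \<le> 1"
    by (auto simp: vrrw_trans_def divide_le_eq_1 sum_nonneg intro!: divide_nonneg_nonneg)
qed

lemma Zcnt_eq_Zhist: "Zcnt z0 X n \<omega> v = Zhist z0 (history (\<lambda>n. X n \<omega>) n) v"
proof (induction n)
  case (Suc n)
  have "{s \<in> {1..Suc n}. X s \<omega> = v}
      = {s \<in> {1..n}. X s \<omega> = v} \<union> (if X (Suc n) \<omega> = v then {Suc n} else {})"
    by (auto simp: le_Suc_eq)
  with Suc show ?case by (auto simp: Zcnt_def Zhist_def history_Suc)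
qed (simp add: Zcnt_def Zhist_def history_def)

locale vrrw_process = prob_space M for M :: "'w measure" +
  fixes d :: nat and r :: "nat \<Rightarrow> nat" and z0 :: "vtx \<Rightarrow> nat" and x0 :: vtx and X :: "nat \<Rightarrow> 'w \<Rightarrow> vtx"
  assumes d_ge_3: "3 \<le> d" and z0_pos: "\<forall>v\<in>verts d r. 0 < z0 v"
    and x0_in_verts: "x0 \<in> verts d r" and law: "vrrw_law M d r z0 x0 X"
begin

sublocale history_process M X "vrrw_trans d r z0"
  using law by unfold_locales (auto simp: vrrw_law_def vrrw_trans_bounds)

abbreviation innovation_of :: "'w \<Rightarrow> vtx set \<Rightarrow> nat \<Rightarrow> real" where
  "innovation_of \<omega> \<equiv> vrrw_path.innovation d r z0 (trajectory \<omega>)"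

lemma AE_vrrw_path: "AE \<omega> in M. vrrw_path d r z0 (trajectory \<omega>)"
proof -
  have "AE \<omega> in M. X 0 \<omega> = x0" using law by (simp add: vrrw_law_def)
  with AE_transition_positive show ?thesis
  proof eventually_elim
    case (elim \<omega>)
    have step: "X (Suc n) \<omega> \<in> verts d r \<and> adj (X n \<omega>) (X (Suc n) \<omega>)" for n
      using elim(1)[rule_format, of n] by (auto simp: vrrw_trans_def split: if_splits)
    have "X n \<omega> \<in> verts d r" for n
      using step elim(2) x0_in_verts by (cases n) auto
    with step show ?case using d_ge_3 z0_pos by unfold_locales auto
  qed
qed

lemma AE_summable_innovation:
  assumes U: "finite U"
    and predictable: "\<And>x k. vrrw_path d r z0 x \<Longrightarrow> c x k = g k (history x k)"
    and bounded: "\<And>x n. vrrw_path d r z0 x \<Longrightarrow> (\<Sum>k<n. (c x k)\<^sup>2 * of_bool (x (Suc k) \<in> U)) \<le> C"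
  shows "AE \<omega> in M. summable (\<lambda>k. c (trajectory \<omega>) k * innovation_of \<omega> U k)"
proof -
  have "AE \<omega> in M. \<forall>n. (\<Sum>k<n. (g k (past k \<omega>))\<^sup>2 * of_bool (X (Suc k) \<omega> \<in> U)) \<le> C"
    using AE_vrrw_path
  proof eventually_elim
    case (elim \<omega>)
    show ?case using bounded[OF elim] predictable[OF elim] by simp
  qed
  from AE_summable_compensated_steps[OF U this] AE_vrrw_path show ?thesis
    by eventually_elim (simp add: vrrw_path.innovation_def predictable)
qed

lemma AE_summable_innovation_Inner:
  assumes i: "i \<in> {1..d}"
  shows "AE \<omega> in M. summable (\<lambda>k. 1 / vrrw_path.Z z0 (trajectory \<omega>) k i
    * innovation_of \<omega> {Inner i} k)"
proof (rule AE_summable_innovation)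
  fix x k n assume "vrrw_path d r z0 x"
  then interpret vrrw_path d r z0 x .
  show "1 / Z k i = 1 / real (Zhist z0 (history x k) (Inner i))"
    by (simp add: Z_def weight_def)
  show "(\<Sum>k<n. (1 / Z k i)\<^sup>2 * of_bool (x (Suc k) \<in> {Inner i})) \<le> 2"
    by (rule sum_squares_over_Z_le[OF i])
qed simp

lemma AE_summable_innovation_leaves:
  assumes i: "i \<in> {1..d}"
  shows "AE \<omega> in M. summable (\<lambda>k. 1 / vrrw_path.L r z0 (trajectory \<omega>) k i
    * innovation_of \<omega> (leaves r i) k)"
proof (rule AE_summable_innovation)
  fix x k n assume "vrrw_path d r z0 x"
  then interpret vrrw_path d r z0 x .
  show "1 / L k i = 1 / (\<Sum>v\<in>leaves r i. real (Zhist z0 (history x k) v))"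
    by (simp add: L_def weight_def)
  show "(\<Sum>k<n. (1 / L k i)\<^sup>2 * of_bool (x (Suc k) \<in> leaves r i)) \<le> 2"
    by (rule sum_squares_over_L_le[OF i])
qed simp

lemma AE_summable_leaf_density_innovation:
  assumes i: "i \<in> {1..d}"
  shows "AE \<omega> in M. summable (\<lambda>k. vrrw_path.leaf_density d r z0 (trajectory \<omega>) k i
    * innovation_of \<omega> (leaves r i) k)"
proof (rule AE_summable_innovation)
  fix x k n assume "vrrw_path d r z0 x"
  then interpret vrrw_path d r z0 x .
  show "leaf_density k i = (\<Sum>v\<in>leaves r i. real (Zhist z0 (history x k) v))
      / (real (tzero d r z0 + k) * real (tzero d r z0 + Suc k))"
    by (simp add: leaf_density_def L_def weight_def T_def)
  show "(\<Sum>k<n. (leaf_density k i)\<^sup>2 * of_bool (x (Suc k) \<in> leaves r i)) \<le> 2"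
    by (rule sum_squares_leaf_density_le[OF i])
qed simp

lemma AE_typical_vrrw_path: "AE \<omega> in M. typical_vrrw_path d r z0 (trajectory \<omega>)"
proof -
  have innovations: "AE \<omega> in M. \<forall>i\<in>{1..d}.
      summable (\<lambda>k. 1 / vrrw_path.Z z0 (trajectory \<omega>) k i
        * innovation_of \<omega> {Inner i} k) \<and>
      summable (\<lambda>k. 1 / vrrw_path.L r z0 (trajectory \<omega>) k i
        * innovation_of \<omega> (leaves r i) k) \<and>
      summable (\<lambda>k. vrrw_path.leaf_density d r z0 (trajectory \<omega>) k i
        * innovation_of \<omega> (leaves r i) k)"
    by (intro AE_finite_allI AE_conjI AE_summable_innovation_Inner AE_summable_innovation_leaves
        AE_summable_leaf_density_innovation) auto
  from AE_vrrw_path innovations show ?thesis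
    by eventually_elim
      (intro typical_vrrw_path.intro typical_vrrw_path_axioms.intro d_ge_3, auto)
qed

lemma AE_occ_tendsto: "AE \<omega> in M. \<forall>v. (\<lambda>n. occ d r z0 X n \<omega> v) \<longlonglongrightarrow> pi_unif d v"
  using AE_typical_vrrw_path
proof (eventually_elim, intro allI)
  fix \<omega> v
  assume "typical_vrrw_path d r z0 (trajectory \<omega>)"
  then interpret typical_vrrw_path d r z0 "trajectory \<omega>" .
  have occ_eq: "occ d r z0 X n \<omega> u = weight n u / T n" if "u \<in> verts d r" for n u
    using that by (simp add: occ_def Zcnt_eq_Zhist weight_def T_def)
  consider (outside) "v \<notin> verts d r" | (inner) i where "i \<in> {1..d}" "v = Inner i"
    | (leaf) i m where "i \<in> {1..d}" "m \<in> {1..r i}" "v = Leaf i m"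
    by (cases v) auto
  then show "(\<lambda>n. occ d r z0 X n \<omega> v) \<longlonglongrightarrow> pi_unif d v"
  proof cases
    case outside
    then show ?thesis by (cases v) (auto simp: occ_def pi_unif_def)
  next
    case (inner i)
    then show ?thesis using inner_proportion_tendsto[of i] by (simp add: occ_eq Z_def pi_unif_def)
  next
    case (leaf i m)
    have "(\<lambda>n. weight n v / T n) \<longlonglongrightarrow> 0"
    proof (rule tendsto_sandwich[OF _ _ tendsto_const leaf_proportion_tendsto[OF leaf(1)]])
      have "weight n v \<le> L n i" for n
        unfolding L_def using leaf by (intro member_le_sum) auto
      then show "\<forall>\<^sub>F n in sequentially. weight n v / T n \<le> L n i / T n"
        by (intro always_eventually allI divide_right_mono) auto
    qed simp
    then show ?thesis using leaf by (simp add: occ_eq pi_unif_def)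
  qed
qed

end

lemma pi_inf_eqI:
  assumes "\<forall>v. (\<lambda>n. occ d r z0 X n \<omega> v) \<longlonglongrightarrow> L v"
  shows "pi_inf d r z0 X \<omega> = L"
proof -
  have "(THE L. \<forall>v. (\<lambda>n. occ d r z0 X n \<omega> v) \<longlonglongrightarrow> L v) = L"
    using assms by (intro the_equality ext) (auto intro: LIMSEQ_unique)
  then show ?thesis using assms by (auto simp: pi_inf_def)
qed

theorem theorem1:
  fixes M :: "'w measure" and d :: nat and r :: "nat \<Rightarrow> nat"
    and z0 :: "vtx \<Rightarrow> nat" and x0 :: vtx and X :: "nat \<Rightarrow> 'w \<Rightarrow> vtx"
  assumes "prob_space M"
    and "d \<ge> 3"
    and "\<forall>v\<in>verts d r. z0 v > 0"
    and "x0 \<in> verts d r"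
    and "vrrw_law M d r z0 x0 X"
  shows "AE \<omega> in M. pi_inf d r z0 X \<omega> = pi_unif d"
proof -
  interpret prob_space M by fact
  interpret vrrw_process M d r z0 x0 X by unfold_locales fact+
  show ?thesis using AE_occ_tendsto by eventually_elim (rule pi_inf_eqI)
qed

end
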